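(* Let $f=f_1+\mathrm{i}f_2$ be piecewise continuous and $2\pi$-periodic, where $f_1$ is real and even and $f_2$ is real and odd, having $k$ zeros $x_1,x_2,\dots,x_k$ in $(-\pi,\pi]$ and $\nu$ points of discontinuity $\xi_1,\xi_2,\dots,\xi_\nu$, also in $(-\pi,\pi]$, with corresponding (finite) jumps $$\alpha_j=\lim_{x\to\xi_j^+}f(x)-\lim_{x\to\xi_j^-}f(x),$$ and suppose that the points $x_j$ are different from the points $\xi_j$. Let $g$ be a trigonometric polynomial such that $\frac fg$ (regarded as a function extended by continuity at the zeros of $g$) has no zeros in $(-\pi,\pi]$, and such that the matrices $T_n(g)$ are invertible. Then for every $\varepsilon>0$ the interval $[1-\varepsilon,1+\varepsilon]$ is a general cluster for the singular values of the preconditioned matrix $$\mathcal{C}_n^{-1}\left(\frac fg\right)T_n^{-1}(g)T_n(f),$$ with $\mathcal{O}(\log n)$ singular values outside the interval.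
   Context: For integrable $2\pi$-periodic $h$, $T_n(h)$ is the $n\times n$ Toeplitz matrix with $(j,k)$ entry $\frac{1}{2\pi}\int_{-\pi}^{\pi}h(x)\mathrm{e}^{-\mathrm{i}(j-k)x}\,\mathrm{d}x$. $\mathcal{C}_n(h)=\mathcal{F}_n^H\Lambda_n(h)\mathcal{F}_n$ is the circulant matrix with eigenvalues $h\left(\frac{2\pi(k-1)}{n}\right)$, $k=1,\dots,n$, where $\Lambda_n(h)$ is the diagonal matrix of these values (in this order) and $\mathcal{F}_n=\frac{1}{\sqrt n}\left(\omega^{(j-1)(k-1)}\right)_{j,k=1}^n$, $\omega=\mathrm{e}^{2\pi\mathrm{i}/n}$. A superscript $-1$ denotes matrix inverse. A set $\Phi$ is a general cluster for the singular values of $\{A_n\}$, $A_n\in\mathbb{C}^{n\times n}$, if for every $\delta>0$ the number of singular values of $A_n$ outside the $\delta$-extension of $\Phi$ (the union of $\Phi$ with all $\delta$-balls centred at its points) is $o(n)$.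
   Formalization: At a discontinuity, a vanishing one-sided limit also counts as a zero, both for f and for f/g; with pointwise zeros only the O(log n) claim fails, e.g. g=1, f(t)=exp(-exp(1/|t|)) for 0<|t|≤π, f(0)=1. *)

theory Defs
  imports
    "HOL-Analysis.Analysis"
    "HOL-Library.Landau_Symbols"
    "HOL-Computational_Algebra.Fundamental_Theorem_Algebra"
    "Jordan_Normal_Form.Gauss_Jordan_Elimination"
    "Jordan_Normal_Form.Char_Poly"
    "Jordan_Normal_Form.Schur_Decomposition"
begin

definition periodic_2pi :: "(real \<Rightarrow> complex) \<Rightarrow> bool" where
  "periodic_2pi f \<longleftrightarrow> (\<forall>x. f (x + 2 * pi) = f x)"

text \<open>Used for functions of period \<open>2\<pi>\<close>, so the half-open interval covers a whole
  period and the behaviour at \<open>-\<pi>\<close> is the behaviour at \<open>\<pi>\<close>.\<close>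

definition discontinuities :: "(real \<Rightarrow> complex) \<Rightarrow> real set" where
  "discontinuities f = {x \<in> {-pi<..pi}. \<not> isCont f x}"

definition piecewise_continuous :: "(real \<Rightarrow> complex) \<Rightarrow> bool" where
  "piecewise_continuous f \<longleftrightarrow>
     finite (discontinuities f) \<and>
     (\<forall>x\<in>{-pi<..pi}. (\<exists>l. (f \<longlongrightarrow> l) (at_left x)) \<and> (\<exists>r. (f \<longlongrightarrow> r) (at_right x)))"

text \<open>A piecewise continuous function vanishes at a point if its value there or one of its
  one-sided limits there is zero. At a point of continuity this just means that the value is zero
  (see below). The limits matter only at discontinuities, where the value of the function itself is
  a matter of convention: a function with a vanishing one-sided limit at a jump is
  not bounded away from zero, whatever value is assigned to it at the jump.\<close>

definition zero_at :: "(real \<Rightarrow> complex) \<Rightarrow> real \<Rightarrow> bool" where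
  "zero_at f x \<longleftrightarrow> f x = 0 \<or> (f \<longlongrightarrow> 0) (at_left x) \<or> (f \<longlongrightarrow> 0) (at_right x)"

lemma zero_at_isCont:
  assumes "isCont f x"
  shows "zero_at f x \<longleftrightarrow> f x = 0"
proof -
  have l: "(f \<longlongrightarrow> f x) (at_left x)" and r: "(f \<longlongrightarrow> f x) (at_right x)"
    using assms unfolding isCont_def filterlim_at_split by simp_all
  have "f x = 0" if "(f \<longlongrightarrow> 0) (at_left x)"
    using tendsto_unique[OF trivial_limit_at_left_real l that] .
  moreover have "f x = 0" if "(f \<longlongrightarrow> 0) (at_right x)"
    using tendsto_unique[OF trivial_limit_at_right_real r that] .
  ultimately show ?thesis
    unfolding zero_at_def by blast
qed

definition zeros :: "(real \<Rightarrow> complex) \<Rightarrow> real set" where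
  "zeros f = {x \<in> {-pi<..pi}. zero_at f x}"

definition trig_polynomial :: "(real \<Rightarrow> complex) \<Rightarrow> bool" where
  "trig_polynomial g \<longleftrightarrow>
     (\<exists>(m::nat) (c :: int \<Rightarrow> complex). \<forall>x.
        g x = (\<Sum>j = - int m..int m. c j * exp (\<i> * of_int j * of_real x)))"

definition continuously_extendable_quotient :: "(real \<Rightarrow> complex) \<Rightarrow> (real \<Rightarrow> complex) \<Rightarrow> bool" where
  "continuously_extendable_quotient f g \<longleftrightarrow>
     (\<forall>x. g x = 0 \<longrightarrow> (\<exists>L. ((\<lambda>t. f t / g t) \<longlongrightarrow> L) (at x)))"

definition extended_quotient :: "(real \<Rightarrow> complex) \<Rightarrow> (real \<Rightarrow> complex) \<Rightarrow> real \<Rightarrow> complex" where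
  "extended_quotient f g x = (if g x = 0 then Lim (at x) (\<lambda>t. f t / g t) else f x / g x)"

text \<open>Matrix indices start from \<open>0\<close>; entry \<open>(j, k)\<close> here is entry \<open>(j+1, k+1)\<close> in the
  usual numbering.\<close>

definition toeplitz :: "nat \<Rightarrow> (real \<Rightarrow> complex) \<Rightarrow> complex mat" where
  "toeplitz n h = Matrix.mat n n (\<lambda>(j, k).
     1 / (2 * pi) * integral {-pi..pi} (\<lambda>x. h x * exp (- \<i> * (of_nat j - of_nat k) * of_real x)))"

definition fourier_mat :: "nat \<Rightarrow> complex mat" where
  "fourier_mat n = Matrix.mat n n (\<lambda>(j, k).
     1 / of_real (sqrt (real n)) * exp (2 * of_real pi * \<i> / of_nat n) ^ (j * k))"

definition circulant :: "nat \<Rightarrow> (real \<Rightarrow> complex) \<Rightarrow> complex mat" where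
  "circulant n h =
     mat_adjoint (fourier_mat n) * mat_diag n (\<lambda>k. h (2 * pi * real k / real n)) * fourier_mat n"

text \<open>The inverse; unspecified if the matrix is not invertible.\<close>

definition mat_inv :: "complex mat \<Rightarrow> complex mat" where
  "mat_inv A = the (mat_inverse A)"

text \<open>The square roots of the eigenvalues of \<open>A\<^sup>H A\<close>, counted with multiplicity. These eigenvalues
  are real and nonnegative, so taking the real part only changes the type.\<close>

definition singular_values :: "complex mat \<Rightarrow> real multiset" where
  "singular_values A =
     image_mset (\<lambda>z. sqrt (Re z)) (proots (char_poly (mat_adjoint A * A)))"

definition num_outside :: "real set \<Rightarrow> complex mat \<Rightarrow> nat" where
  "num_outside S A = size {#s \<in># singular_values A. s \<notin> S#}"

definition delta_extension :: "real \<Rightarrow> real set \<Rightarrow> real set" where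
  "delta_extension \<delta> \<Phi> = \<Phi> \<union> (\<Union>x\<in>\<Phi>. ball x \<delta>)"

definition general_cluster :: "real set \<Rightarrow> (nat \<Rightarrow> complex mat) \<Rightarrow> bool" where
  "general_cluster \<Phi> A \<longleftrightarrow>
     (\<forall>\<delta>>0. (\<lambda>n. real (num_outside (delta_extension \<delta> \<Phi>) (A n))) \<in> o(\<lambda>n. real n))"

end

theory Submission
  imports Defs
begin

text \<open>
  Let \<open>h\<close> be the extended quotient \<open>f / g\<close>. It is piecewise continuous and bounded away from zero,
  and \<open>f = g h\<close>. With \<open>C = C\<^sub>n(h)\<close> and \<open>A = C\<^sup>-\<^sup>1 T\<^sub>n(g)\<^sup>-\<^sup>1 T\<^sub>n(f)\<close>, the matrix \<open>A - 1\<close> is split into a part of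
  bounded rank, a part of small operator norm and a part whose squared Frobenius norm
  is \<open>O(log n)\<close>. Each part comes from one observation.

  Since \<open>g\<close> is a trigonometric polynomial, \<open>S = T\<^sub>n(g h) - T\<^sub>n(g) T\<^sub>n(h)\<close> vanishes outside the first and the
  last \<open>m\<close> rows, where \<open>m\<close> is the degree of \<open>g\<close> (\<open>toeplitz_product_interior_rows\<close>). Thus
  \<open>A = C\<^sup>-\<^sup>1 T\<^sub>n(h) + X S\<close> for some \<open>X\<close>, and however large \<open>T\<^sub>n(g)\<^sup>-\<^sup>1\<close> may be, the kernel
  of \<open>X S\<close> has codimension at most \<open>2 m\<close>.

  The function \<open>h\<close> is uniformly close to a step function \<open>\<sigma>\<close> (\<open>regulated_step_approx\<close>). The operator
  norms of \<open>T\<^sub>n(\<phi>)\<close> and \<open>C\<^sub>n(\<phi>)\<close> are at most the supremum of \<open>\<bar>\<phi>\<bar>\<close> (\<open>vnorm_coeff_toeplitz_le\<close>,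
  \<open>vnorm_circulant_le\<close>), which is applied to \<open>\<phi> = h - \<sigma>\<close> and, because of \<open>C\<^sup>-\<^sup>1 = C\<^sub>n(1 / h)\<close>,
  to \<open>1 / h\<close>.

  For a step function the squared Frobenius norm of \<open>T\<^sub>n(\<sigma>) - C\<^sub>n(\<sigma>)\<close> is \<open>O(log n)\<close>
  (\<open>frobenius_sq_sampling_error_step\<close>). The entries of \<open>C\<^sub>n(\<sigma>)\<close> are Riemann sums for
  the Fourier coefficients in \<open>T\<^sub>n(\<sigma>)\<close>. On the diagonal \<open>l\<close> they are off by \<open>O(1 / n)\<close>, except
  towards the two corners, where the error is \<open>O(1 / (n - \<bar>l\<bar>))\<close> (\<open>coeff_error_indicator\<close>); as this
  diagonal has \<open>n - \<bar>l\<bar>\<close> entries, a harmonic sum appears.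

  Outlying singular values are then counted by dimension (\<open>num_outside_le\<close>). On the
  span of the right singular vectors belonging to singular values above \<open>1 + \<epsilon>\<close>, or below
  \<open>1 - \<epsilon>\<close>, the norms of \<open>A v\<close> and \<open>v\<close> differ by at least \<open>\<epsilon> |v|\<close>. After restriction to the kernel of \<open>S\<close>
  and subtraction of the part of small norm, the third part is still bounded below on an orthonormal
  family, and Bessel's inequality bounds the length of this family by a multiple of the
  squared Frobenius norm.
\<close>

unbundle no vec_syntax

section \<open>Adjoints, norms and isometries\<close>

lemma dim_mat_adjoint [simp]:
  "dim_row (mat_adjoint A) = dim_col A" "dim_col (mat_adjoint A) = dim_row A"
  by (auto simp: mat_adjoint_def mat_of_rows_def)

lemma index_mat_adjoint [simp]:
  fixes A :: "complex mat"
  shows "i < dim_col A \<Longrightarrow> j < dim_row A \<Longrightarrow> mat_adjoint A $$ (i, j) = cnj (A $$ (j, i))"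
  by (auto simp: mat_adjoint_def mat_of_rows_def)

lemma mat_adjoint_carrier [simp]:
  "A \<in> carrier_mat n m \<Longrightarrow> mat_adjoint A \<in> carrier_mat m n"
  unfolding carrier_mat_def by simp

lemma mat_adjoint_adjoint [simp]: "mat_adjoint (mat_adjoint A) = (A :: complex mat)"
  by (rule eq_matI) auto

lemma mat_adjoint_mult:
  fixes A B :: "complex mat"
  assumes "A \<in> carrier_mat n m" "B \<in> carrier_mat m p"
  shows "mat_adjoint (A * B) = mat_adjoint B * mat_adjoint A"
  by (rule eq_matI) (use assms in \<open>auto simp: scalar_prod_def mult.commute\<close>)

lemma mat_assoc:
  assumes "dim_col A = dim_row B" "dim_col B = dim_row C"
  shows "A * B * C = A * (B * C)"
proof -
  have A: "A \<in> carrier_mat (dim_row A) (dim_col A)" by (rule carrier_matI) simp_all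
  have B: "B \<in> carrier_mat (dim_col A) (dim_col B)" by (rule carrier_matI) (simp_all add: assms(1))
  have C: "C \<in> carrier_mat (dim_col B) (dim_col C)" by (rule carrier_matI) (simp_all add: assms(2))
  show ?thesis by (rule assoc_mult_mat[OF A B C])
qed

text \<open>Squared norms are the primary notion because all counting below is done with sums of them.\<close>

definition vnorm_sq :: "complex vec \<Rightarrow> real" where
  "vnorm_sq v = (\<Sum>i<dim_vec v. (cmod (v $ i))\<^sup>2)"

definition frobenius_sq :: "complex mat \<Rightarrow> real" where
  "frobenius_sq M = (\<Sum>j<dim_col M. vnorm_sq (col M j))"

lemma vnorm_sq_nonneg [simp]: "vnorm_sq v \<ge> 0"
  unfolding vnorm_sq_def by (intro sum_nonneg) auto

lemma frobenius_sq_nonneg [simp]: "frobenius_sq v \<ge> 0"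
  unfolding frobenius_sq_def by (intro sum_nonneg) auto

lemma cnj_mult_self: "cnj z * z = (complex_of_real (cmod z))\<^sup>2" "z * cnj z = (complex_of_real (cmod z))\<^sup>2"
  by (simp_all add: complex_norm_square[symmetric] mult.commute[of "cnj z"])

lemma vnorm_sq_cscalar: "complex_of_real (vnorm_sq v) = v \<bullet>c v"
  by (auto simp: vnorm_sq_def scalar_prod_def atLeast0LessThan complex_norm_square[symmetric])

lemma vnorm_sq_zero_iff: "v \<in> carrier_vec n \<Longrightarrow> vnorm_sq v = 0 \<longleftrightarrow> v = 0\<^sub>v n"
  unfolding vnorm_sq_def by (subst sum_nonneg_eq_0_iff) (auto intro!: eq_vecI)

lemma cscalar_mat_adjoint:
  fixes A :: "complex mat"
  assumes A: "A \<in> carrier_mat n m" and "v \<in> carrier_vec m" "w \<in> carrier_vec n"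
  shows "(A *\<^sub>v v) \<bullet>c w = v \<bullet>c (mat_adjoint A *\<^sub>v w)"
proof -
  have "(A *\<^sub>v v) \<bullet>c w = (\<Sum>i<n. \<Sum>j<m. A $$ (i,j) * v $ j * cnj (w $ i))"
    using assms by (auto simp: scalar_prod_def atLeast0LessThan sum_distrib_right)
  also have "\<dots> = (\<Sum>j<m. \<Sum>i<n. A $$ (i,j) * v $ j * cnj (w $ i))"
    by (rule sum.swap)
  also have "\<dots> = v \<bullet>c (mat_adjoint A *\<^sub>v w)"
    using assms by (auto simp: scalar_prod_def atLeast0LessThan sum_distrib_left mult_ac)
  finally show ?thesis .
qed

lemma Re_cscalar_le:
  assumes "v \<in> carrier_vec n" "w \<in> carrier_vec n"
  shows "2 * Re (v \<bullet>c w) \<le> vnorm_sq v + vnorm_sq w"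
proof -
  have "2 * Re (a * cnj b) \<le> (cmod a)\<^sup>2 + (cmod b)\<^sup>2" for a b
  proof -
    have "Re (a * cnj b) \<le> cmod a * cmod b"
      using complex_Re_le_cmod[of "a * cnj b"] by (simp add: norm_mult)
    then show ?thesis using sum_squares_bound[of "cmod a" "cmod b"] by simp
  qed
  then have "(\<Sum>i<n. 2 * Re (v $ i * cnj (w $ i))) \<le> (\<Sum>i<n. (cmod (v$i))\<^sup>2 + (cmod (w$i))\<^sup>2)"
    by (intro sum_mono)
  then show ?thesis using assms
    by (simp add: vnorm_sq_def scalar_prod_def atLeast0LessThan sum.distrib sum_distrib_left)
qed

lemma vnorm_sq_mult_isometry:
  assumes V: "V \<in> carrier_mat n p" and "mat_adjoint V * V = 1\<^sub>m p" and v: "v \<in> carrier_vec p"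
  shows "vnorm_sq (V *\<^sub>v v) = vnorm_sq v"
proof -
  have "complex_of_real (vnorm_sq (V *\<^sub>v v)) = v \<bullet>c (mat_adjoint V *\<^sub>v (V *\<^sub>v v))"
    unfolding vnorm_sq_cscalar using V v by (intro cscalar_mat_adjoint) auto
  also have "mat_adjoint V *\<^sub>v (V *\<^sub>v v) = v"
    using assms by (subst assoc_mult_mat_vec[symmetric]) auto
  finally show ?thesis unfolding vnorm_sq_cscalar[symmetric] by simp
qed

text \<open>With \<open>y = V\<^sup>H w\<close> one has \<open>|y|\<^sup>2 = \<langle>w, V y\<rangle>\<close>, and the inequality between arithmetic and geometric
  mean bounds this by \<open>(|w|\<^sup>2 + |y|\<^sup>2) / 2\<close>. For an isometry this is Bessel's inequality.\<close>

lemma vnorm_sq_adjoint_contraction: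
  assumes V: "V \<in> carrier_mat n p" and contr: "\<And>v. v \<in> carrier_vec p \<Longrightarrow> vnorm_sq (V *\<^sub>v v) \<le> vnorm_sq v"
    and w: "w \<in> carrier_vec n"
  shows "vnorm_sq (mat_adjoint V *\<^sub>v w) \<le> vnorm_sq w"
proof -
  define y where "y = mat_adjoint V *\<^sub>v w"
  have y: "y \<in> carrier_vec p"
    unfolding y_def using V w by (intro mult_mat_vec_carrier[of _ _ n]) auto
  have "complex_of_real (vnorm_sq y) = w \<bullet>c (V *\<^sub>v y)"
    using cscalar_mat_adjoint[of "mat_adjoint V" p n w y] V w y
    unfolding vnorm_sq_cscalar y_def by simp
  then have "vnorm_sq y = Re (w \<bullet>c (V *\<^sub>v y))" by (metis Re_complex_of_real)
  moreover have "2 * Re (w \<bullet>c (V *\<^sub>v y)) \<le> vnorm_sq w + vnorm_sq (V *\<^sub>v y)"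
    using V w y by (intro Re_cscalar_le) auto
  ultimately show ?thesis using contr[OF y] y_def by simp
qed

definition vnorm :: "complex vec \<Rightarrow> real" where
  "vnorm v = sqrt (vnorm_sq v)"

lemma vnorm_triangle:
  assumes "v \<in> carrier_vec n" "w \<in> carrier_vec n"
  shows "vnorm (v + w) \<le> vnorm v + vnorm w"
proof -
  have "vnorm (v + w) = L2_set (\<lambda>i. cmod (v $ i + w $ i)) {..<n}"
    using assms by (auto simp: vnorm_def vnorm_sq_def L2_set_def)
  also have "\<dots> \<le> L2_set (\<lambda>i. cmod (v $ i) + cmod (w $ i)) {..<n}"
    by (intro L2_set_mono norm_triangle_ineq) auto
  also have "\<dots> \<le> L2_set (\<lambda>i. cmod (v $ i)) {..<n} + L2_set (\<lambda>i. cmod (w $ i)) {..<n}"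
    by (rule L2_set_triangle_ineq)
  finally show ?thesis using assms by (auto simp: vnorm_def vnorm_sq_def L2_set_def)
qed

lemma vnorm_uminus: "vnorm (- v) = vnorm v"
  by (simp add: vnorm_def vnorm_sq_def)

lemma vnorm_nonneg [simp]: "vnorm v \<ge> 0"
  by (simp add: vnorm_def)

lemma vnorm_sq_le_of_vnorm: "vnorm v \<le> b * vnorm w \<Longrightarrow> vnorm_sq v \<le> b\<^sup>2 * vnorm_sq w"
  using power_mono[of "vnorm v" "b * vnorm w" 2] by (simp add: vnorm_def power_mult_distrib)

lemma frobenius_sq_entries: "frobenius_sq M = (\<Sum>i<dim_row M. \<Sum>j<dim_col M. (cmod (M $$ (i,j)))\<^sup>2)"
  unfolding frobenius_sq_def vnorm_sq_def by (subst sum.swap) simp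

lemma frobenius_sq_adjoint [simp]: "frobenius_sq (mat_adjoint M) = frobenius_sq M"
  unfolding frobenius_sq_entries by (subst sum.swap) simp

lemma frobenius_sq_mult_left_le:
  assumes B: "B \<in> carrier_mat k n" and L: "L \<in> carrier_mat n p"
    and b: "\<And>v. v \<in> carrier_vec n \<Longrightarrow> vnorm_sq (B *\<^sub>v v) \<le> b * vnorm_sq v"
  shows "frobenius_sq (B * L) \<le> b * frobenius_sq L"
proof -
  have "vnorm_sq (col (B * L) j) \<le> b * vnorm_sq (col L j)" if "j < p" for j
    using b[of "col L j"] B L that by (subst col_mult2) auto
  then have "(\<Sum>j<p. vnorm_sq (col (B * L) j)) \<le> (\<Sum>j<p. b * vnorm_sq (col L j))"
    by (intro sum_mono) auto
  then show ?thesis using B L by (simp add: frobenius_sq_def sum_distrib_left)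
qed

text \<open>Bessel's inequality applied to every row of \<open>L\<close>. It is what limits the number of orthonormal
  vectors on which a matrix of given Frobenius norm can be large.\<close>

lemma frobenius_sq_mult_isometry_le:
  assumes V: "V \<in> carrier_mat n p" and VV: "mat_adjoint V * V = 1\<^sub>m p" and L: "L \<in> carrier_mat k n"
  shows "frobenius_sq (L * V) \<le> frobenius_sq L"
proof -
  have "frobenius_sq (mat_adjoint V * mat_adjoint L) \<le> 1 * frobenius_sq (mat_adjoint L)"
    by (rule frobenius_sq_mult_left_le[of _ p n _ k]) (use V L vnorm_sq_adjoint_contraction[OF V] vnorm_sq_mult_isometry[OF V VV] in auto)
  then show ?thesis
    using mat_adjoint_mult[OF L V] frobenius_sq_adjoint[of "L * V"] by simp
qed

section \<open>The spectral theorem for Hermitian matrices\<close>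

text \<open>Used for deflation, with an eigenvector \<open>v\<close>: Gram-Schmidt extends it to an orthogonal basis, which is then
  normalised.\<close>

lemma unitary_with_first_column:
  fixes v :: "complex vec"
  assumes v: "v \<in> carrier_vec n" and v0: "v \<noteq> 0\<^sub>v n"
  obtains W c where "W \<in> carrier_mat n n" "mat_adjoint W * W = 1\<^sub>m n" "col W 0 = c \<cdot>\<^sub>v v" "c \<noteq> 0"
proof -
  interpret cof_vec_space n "TYPE(complex)" .
  define b where "b = basis_completion v"
  define ws where "ws = gram_schmidt n b"
  note bc = basis_completion[OF v v0, folded b_def]
  have n: "n \<noteq> 0" using v v0 by auto
  obtain vs where bv: "b = v # vs" using bc n by (cases b) auto
  note gs = gram_schmidt_result[OF bc(2,4,5) refl, folded ws_def]
  have len: "length ws = n" using gs(4) bc by simp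
  have hd: "ws ! 0 = v"
    using gram_schmidt_hd[OF v, of vs] len n unfolding ws_def bv by (metis hd_conv_nth list.size(3))
  have wsc: "ws ! i \<in> carrier_vec n" if "i < n" for i using gs(3) len that by auto
  have pos: "vnorm_sq (ws ! i) > 0" if "i < n" for i
  proof -
    have "ws ! i \<bullet>c ws ! i \<noteq> 0" using corthogonalD[OF gs(2), of i i] that len by simp
    then have "vnorm_sq (ws ! i) \<noteq> 0" unfolding vnorm_sq_cscalar[symmetric] by simp
    then show ?thesis by (simp add: less_le)
  qed
  define nn where "nn i = complex_of_real (1 / sqrt (vnorm_sq (ws ! i)))" for i
  define W where "W = Matrix.mat n n (\<lambda>(j, i). nn i * (ws ! i) $ j)"
  have W: "W \<in> carrier_mat n n" unfolding W_def by simp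
  have "mat_adjoint W * W = 1\<^sub>m n"
  proof (rule eq_matI)
    fix i j assume "i < dim_row (1\<^sub>m n :: complex mat)" "j < dim_col (1\<^sub>m n :: complex mat)"
    then have ij: "i < n" "j < n" by auto
    have "(mat_adjoint W * W) $$ (i, j) = (\<Sum>k<n. cnj (nn i * (ws!i) $ k) * (nn j * (ws!j) $ k))"
      using ij by (auto simp: W_def scalar_prod_def atLeast0LessThan)
    also have "\<dots> = nn i * nn j * (\<Sum>k<n. (ws!j) $ k * cnj ((ws!i) $ k))"
      by (simp add: sum_distrib_left mult_ac nn_def)
    also have "(\<Sum>k<n. (ws!j) $ k * cnj ((ws!i) $ k)) = ws ! j \<bullet>c ws ! i"
      using wsc[OF ij(1)] wsc[OF ij(2)] by (auto simp: scalar_prod_def atLeast0LessThan)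
    also have "nn i * nn j * (ws ! j \<bullet>c ws ! i) = (if i = j then 1 else 0)"
    proof (cases "i = j")
      case True
      have "nn i * nn i * complex_of_real (vnorm_sq (ws ! i)) = 1"
        using pos[OF ij(1)] unfolding nn_def of_real_mult[symmetric] by (simp del: of_real_mult of_real_divide)
      then show ?thesis using True by (simp add: vnorm_sq_cscalar)
    next
      case False
      then show ?thesis using corthogonalD[OF gs(2), of j i] ij len by auto
    qed
    finally show "(mat_adjoint W * W) $$ (i, j) = 1\<^sub>m n $$ (i, j)" using ij by simp
  qed (auto simp: W_def)
  moreover have "col W 0 = nn 0 \<cdot>\<^sub>v v"
    using n v hd by (intro eq_vecI) (auto simp: W_def)
  moreover have "nn 0 \<noteq> 0" using pos[of 0] n by (auto simp: nn_def)
  ultimately show ?thesis using that W by blast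
qed

text \<open>Induction by deflation: in a basis starting with an eigenvector the first column of the matrix
  vanishes off the diagonal, hence by symmetry so does the first row, and the remaining block is again Hermitian.\<close>

lemma hermitian_spectral:
  fixes H :: "complex mat"
  assumes "H \<in> carrier_mat n n" "mat_adjoint H = H"
  shows "\<exists>U d. U \<in> carrier_mat n n \<and> mat_adjoint U * U = 1\<^sub>m n \<and> mat_adjoint U * H * U = mat_diag n d"
  using assms
proof (induction n arbitrary: H)
  case 0
  show ?case by (rule exI[of _ "1\<^sub>m 0"], rule exI[of _ "\<lambda>_. 0"]) (use 0 in \<open>auto simp: mat_diag_def\<close>)
next
  case (Suc n)
  note H = Suc.prems(1)
  obtain as where as: "char_poly H = (\<Prod>a\<leftarrow>as. [:- a, 1:])" "length as = Suc n"
    using char_poly_factorized[OF H] by auto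
  then obtain e as' where "as = e # as'" by (cases as) auto
  then have "poly (char_poly H) e = 0" using as by simp
  then have "eigenvalue H e" using eigenvalue_root_char_poly[OF H] by simp
  then obtain v where v: "v \<in> carrier_vec (Suc n)" "v \<noteq> 0\<^sub>v (Suc n)" "H *\<^sub>v v = e \<cdot>\<^sub>v v"
    unfolding eigenvalue_def eigenvector_def using H by auto
  obtain W c where W: "W \<in> carrier_mat (Suc n) (Suc n)" "mat_adjoint W * W = 1\<^sub>m (Suc n)"
    "col W 0 = c \<cdot>\<^sub>v v" "c \<noteq> 0" using unitary_with_first_column[OF v(1,2)] by metis
  define B where "B = mat_adjoint W * H * W"
  have B: "B \<in> carrier_mat (Suc n) (Suc n)" using W H unfolding B_def by auto
  have adjB: "mat_adjoint B = B"
  proof -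
    have "mat_adjoint B = mat_adjoint W * (mat_adjoint H * mat_adjoint (mat_adjoint W))"
      unfolding B_def using W H
      by (subst mat_adjoint_mult[of _ "Suc n" "Suc n" _ "Suc n"]) (auto simp: mat_adjoint_mult[of _ "Suc n" "Suc n" _ "Suc n"])
    then show ?thesis unfolding B_def Suc.prems(2) mat_adjoint_adjoint
      by (simp add: mat_assoc carrier_matD[OF W(1)] carrier_matD[OF H])
  qed
  have col0: "col B 0 = e \<cdot>\<^sub>v unit_vec (Suc n) 0"
  proof -
    have "col B 0 = (mat_adjoint W * H) *\<^sub>v col W 0"
      unfolding B_def using W H by (subst col_mult2) auto
    also have "\<dots> = mat_adjoint W *\<^sub>v (H *\<^sub>v col W 0)"
      using W(1) H by (intro assoc_mult_mat_vec[of _ "Suc n" "Suc n" _ "Suc n"] col_carrier_vec) auto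
    also have "H *\<^sub>v col W 0 = e \<cdot>\<^sub>v col W 0"
      using W v H by (simp add: mult_mat_vec[of H "Suc n" "Suc n"] smult_smult_assoc mult.commute)
    also have "mat_adjoint W *\<^sub>v (e \<cdot>\<^sub>v col W 0) = e \<cdot>\<^sub>v (mat_adjoint W *\<^sub>v col W 0)"
      using W(1) by (intro mult_mat_vec[of _ "Suc n" "Suc n"] col_carrier_vec) auto
    also have "mat_adjoint W *\<^sub>v col W 0 = col (mat_adjoint W * W) 0"
      using W by (subst col_mult2[of _ "Suc n" "Suc n" _ "Suc n"]) auto
    also have "\<dots> = unit_vec (Suc n) 0" using W by simp
    finally show ?thesis .
  qed
  have B0: "B $$ (i, 0) = (if i = 0 then e else 0)" if "i < Suc n" for i
    using arg_cong[OF col0, of "\<lambda>v. v $ i"] that B by (auto simp: unit_vec_def)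
  have B0': "B $$ (0, j) = (if j = 0 then e else 0)" if "j < Suc n" for j
  proof (cases "j = 0")
    case False
    then show ?thesis using arg_cong[OF adjB, of "\<lambda>M. M $$ (0, j)"] that B B0[of j] by simp
  qed (use B0 in auto)
  define C where "C = Matrix.mat n n (\<lambda>(i, j). B $$ (Suc i, Suc j))"
  have C: "C \<in> carrier_mat n n" by (simp add: C_def)
  have "mat_adjoint C = C"
  proof (rule eq_matI)
    fix i j assume "i < dim_row C" "j < dim_col C"
    then show "mat_adjoint C $$ (i, j) = C $$ (i, j)"
      using arg_cong[OF adjB, of "\<lambda>M. M $$ (Suc i, Suc j)"] B by (auto simp: C_def)
  qed (auto simp: C_def)
  from Suc.IH[OF C this] obtain V d where V: "V \<in> carrier_mat n n" "mat_adjoint V * V = 1\<^sub>m n"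
    "mat_adjoint V * C * V = mat_diag n d" by blast
  define X where "X = four_block_mat (1\<^sub>m 1) (0\<^sub>m 1 n) (0\<^sub>m n 1) V"
  have X: "X \<in> carrier_mat (Suc n) (Suc n)" using V unfolding X_def by auto
  have adjX: "mat_adjoint X = four_block_mat (1\<^sub>m 1) (0\<^sub>m 1 n) (0\<^sub>m n 1) (mat_adjoint V)"
    by (rule eq_matI) (use V in \<open>auto simp: X_def\<close>)
  have XX: "mat_adjoint X * X = 1\<^sub>m (Suc n)"
    unfolding adjX unfolding X_def using V
    by (subst mult_four_block_mat[of _ 1 1 _ n _ n _ _ 1 _ n]) (auto simp: four_block_one_mat)
  have Bblock: "B = four_block_mat (e \<cdot>\<^sub>m 1\<^sub>m 1) (0\<^sub>m 1 n) (0\<^sub>m n 1) C"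
    by (rule eq_matI) (use B B0 B0' in \<open>auto simp: C_def\<close>)
  have XBX: "mat_adjoint X * B * X = mat_diag (Suc n) (\<lambda>i. if i = 0 then e else d (i - 1))"
  proof -
    have "mat_adjoint X * B * X = four_block_mat (e \<cdot>\<^sub>m 1\<^sub>m 1) (0\<^sub>m 1 n) (0\<^sub>m n 1) (mat_diag n d)"
    proof -
      have "mat_adjoint X * B = four_block_mat (e \<cdot>\<^sub>m 1\<^sub>m 1) (0\<^sub>m 1 n) (0\<^sub>m n 1) (mat_adjoint V * C)"
        unfolding adjX Bblock using V C
        by (subst mult_four_block_mat[of _ 1 1 _ n _ n _ _ 1 _ n]) auto
      then show ?thesis unfolding X_def V(3)[symmetric] using V(1) C
        by (simp only:, subst mult_four_block_mat[of _ 1 1 _ n _ n _ _ 1 _ n]) auto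
    qed
    also have "\<dots> = mat_diag (Suc n) (\<lambda>i. if i = 0 then e else d (i - 1))"
      by (rule eq_matI) (auto simp: mat_diag_def)
    finally show ?thesis .
  qed
  have adj: "mat_adjoint (W * X) = mat_adjoint X * mat_adjoint W"
    using mat_adjoint_mult[OF W(1) X] .
  have "mat_adjoint (W * X) * (W * X) = mat_adjoint X * ((mat_adjoint W * W) * X)"
    unfolding adj by (simp add: mat_assoc carrier_matD[OF W(1)] carrier_matD[OF X])
  then have 1: "mat_adjoint (W * X) * (W * X) = 1\<^sub>m (Suc n)" using W X XX by simp
  have "mat_adjoint (W * X) * H * (W * X) = mat_adjoint X * B * X"
    unfolding adj B_def by (simp add: mat_assoc carrier_matD[OF W(1)] carrier_matD[OF X] carrier_matD[OF H])
  with XBX have "mat_adjoint (W * X) * H * (W * X) = mat_diag (Suc n) (\<lambda>i. if i = 0 then e else d (i - 1))"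
    by (rule trans[rotated])
  moreover have "W * X \<in> carrier_mat (Suc n) (Suc n)" using W(1) X by (rule mult_carrier_mat)
  ultimately show ?case using 1 by blast
qed

section \<open>Singular values outside an interval\<close>

lemma gram_diagonal:
  fixes M :: "complex mat"
  assumes "i < dim_col M"
  shows "(mat_adjoint M * M) $$ (i, i) = of_real (vnorm_sq (col M i))"
  using assms by (auto simp: scalar_prod_def vnorm_sq_def atLeast0LessThan cnj_mult_self)

lemma proots_char_poly_unitary_diag:
  fixes H :: "complex mat"
  assumes H: "H \<in> carrier_mat n n" and U: "U \<in> carrier_mat n n"
    and UU: "mat_adjoint U * U = 1\<^sub>m n" and D: "mat_adjoint U * H * U = mat_diag n d"
  shows "proots (char_poly H) = mset (map d [0..<n])"
proof -
  have UU': "U * mat_adjoint U = 1\<^sub>m n"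
    by (rule mat_mult_left_right_inverse[OF _ U UU]) (use U in simp)
  have "similar_mat_wit (mat_diag n d) H (mat_adjoint U) U"
    by (rule similar_mat_witI[OF UU UU']) (use H U D in auto)
  then have "char_poly H = char_poly (mat_diag n d)"
    using char_poly_similar unfolding similar_mat_def by metis
  also have "\<dots> = (\<Prod>a\<leftarrow>diag_mat (mat_diag n d). [:- a, 1:])"
    by (rule char_poly_upper_triangular[of _ n]) (auto simp: mat_diag_def)
  also have "diag_mat (mat_diag n d) = map d [0..<n]"
    by (auto simp: diag_mat_def mat_diag_def)
  finally have "proots (char_poly H) = (\<Sum>p\<leftarrow>map (\<lambda>a. [:- a, 1:]) (map d [0..<n]). proots p)"
    by (subst proots_prod_list[symmetric]) (auto simp: o_def)
  also have "\<dots> = mset (map d [0..<n])"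
  proof -
    have "(\<Sum>p\<leftarrow>map (\<lambda>a. [:- a, 1:]) as. proots p) = mset as" for as :: "complex list"
      by (induction as) auto
    then show ?thesis .
  qed
  finally show ?thesis .
qed

text \<open>The numbers \<open>t i\<close> are the squared singular values, and the columns of \<open>U\<close> are right singular vectors.
  This turns the multiset of roots of a characteristic polynomial into a count of indices.\<close>

lemma num_outside_singular_vectors:
  assumes A: "A \<in> carrier_mat n n"
  obtains U t where "U \<in> carrier_mat n n" "mat_adjoint U * U = 1\<^sub>m n"
    "mat_adjoint U * (mat_adjoint A * A) * U = mat_diag n (\<lambda>i. complex_of_real (t i))"
    "\<And>i. i < n \<Longrightarrow> t i \<ge> 0"
    "\<And>S. num_outside S A = card {i. i < n \<and> sqrt (t i) \<notin> S}"
proof -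
  define G where "G = mat_adjoint A * A"
  have G: "G \<in> carrier_mat n n" using A unfolding G_def by auto
  have "mat_adjoint G = G"
    unfolding G_def using A by (subst mat_adjoint_mult[of _ n n _ n]) auto
  from hermitian_spectral[OF G this] obtain U d where
    U: "U \<in> carrier_mat n n" "mat_adjoint U * U = 1\<^sub>m n" "mat_adjoint U * G * U = mat_diag n d"
    by blast
  define t where "t i = vnorm_sq (col (A * U) i)" for i
  have gram: "mat_adjoint U * G * U = mat_adjoint (A * U) * (A * U)"
    unfolding G_def mat_adjoint_mult[OF A U(1)] 
      by (simp add: mat_assoc carrier_matD[OF A] carrier_matD[OF U(1)])
  have d: "d i = of_real (t i)" if "i < n" for i
  proof -
    have "i < dim_col (A * U)" using U(1) that by simp
    from gram_diagonal[OF this] show ?thesis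
      unfolding gram[symmetric] U(3) t_def using that by (simp add: mat_diag_def)
  qed
  have diag: "mat_adjoint U * G * U = mat_diag n (\<lambda>i. complex_of_real (t i))"
    unfolding U(3) by (rule eq_matI) (auto simp: mat_diag_def d)
  have sv: "singular_values A = mset (map (\<lambda>i. sqrt (t i)) [0..<n])"
    unfolding singular_values_def G_def[symmetric]
      proots_char_poly_unitary_diag[OF G U(1,2) diag] by (simp add: multiset.map_comp o_def)
  have "num_outside S A = card {i. i < n \<and> sqrt (t i) \<notin> S}" for S
  proof -
    have "num_outside S A = length (filter (\<lambda>s. s \<notin> S) (map (\<lambda>i. sqrt (t i)) [0..<n]))"
      unfolding num_outside_def sv by (metis mset_filter size_mset)
    also have "\<dots> = card {i. i < n \<and> sqrt (t i) \<notin> S}"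
      unfolding length_filter_conv_card by (rule arg_cong[where f = card]) auto
    finally show ?thesis .
  qed
  with that[OF U(1,2) diag[unfolded G_def]] show ?thesis by (simp add: t_def)
qed

text \<open>A matrix supported on the rows in \<open>J\<close> has rank at most \<open>card J\<close>. Here an orthonormal basis is needed,
  at least \<open>p - card J\<close> members of which are annihilated. The eigenvectors of the Gram matrix form one:
  the nonzero ones among their images are orthogonal, and after normalisation they
  have total weight at most one on each coordinate in \<open>J\<close> by Bessel's inequality.\<close>

lemma kernel_columns:
  fixes M :: "complex mat"
  assumes M: "M \<in> carrier_mat n p" and J: "finite J"
    and zero: "\<And>i j. i < n \<Longrightarrow> i \<notin> J \<Longrightarrow> j < p \<Longrightarrow> M $$ (i, j) = 0"
  obtains W where "W \<in> carrier_mat p p" "mat_adjoint W * W = 1\<^sub>m p"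
    "p \<le> card {i. i < p \<and> M *\<^sub>v col W i = 0\<^sub>v n} + card J"
proof -
  define G where "G = mat_adjoint M * M"
  have G: "G \<in> carrier_mat p p" using M unfolding G_def by auto
  have "mat_adjoint G = G"
    unfolding G_def using M by (subst mat_adjoint_mult[of _ p n _ p]) auto
  from hermitian_spectral[OF G this] obtain W d where
    W: "W \<in> carrier_mat p p" "mat_adjoint W * W = 1\<^sub>m p" "mat_adjoint W * G * W = mat_diag p d"
    by blast
  define N where "N = M * W"
  have N: "N \<in> carrier_mat n p" using M W unfolding N_def by auto
  have NN: "mat_adjoint N * N = mat_diag p d"
  proof -
    have "mat_adjoint N * N = mat_adjoint W * ((mat_adjoint M * M) * W)"
      unfolding N_def mat_adjoint_mult[OF M W(1)] 
      by (simp add: mat_assoc carrier_matD[OF M] carrier_matD[OF W(1)])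
    then show ?thesis using W(3) unfolding G_def[symmetric] by (simp add: mat_assoc carrier_matD[OF W(1)] carrier_matD[OF G])
  qed
  define q where "q i = vnorm_sq (col N i)" for i
  have d: "d i = of_real (q i)" if "i < p" for i
  proof -
    have "i < dim_col N" using N that by simp
    from gram_diagonal[OF this] show ?thesis
      unfolding NN q_def using that by (simp add: mat_diag_def)
  qed
  \<comment> \<open>The columns of \<open>Y\<close> are the images of the basis, normalised unless they vanish.\<close>
  define e where "e i = (if q i = 0 then 0 else 1 / sqrt (q i))" for i
  have q0: "q i \<ge> 0" for i unfolding q_def by simp
  define Y where "Y = Matrix.mat n p (\<lambda>(j, i). N $$ (j, i) * of_real (e i))"
  have Y: "Y \<in> carrier_mat n p" unfolding Y_def by simp
  have YY: "mat_adjoint Y * Y = mat_diag p (\<lambda>i. if q i = 0 then 0 else 1)"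
  proof (rule eq_matI)
    fix i j assume "i < dim_row (mat_diag p (\<lambda>i. if q i = 0 then 0 else (1::complex)))"
      "j < dim_col (mat_diag p (\<lambda>i. if q i = 0 then 0 else (1::complex)))"
    then have ij: "i < p" "j < p" by (auto simp: mat_diag_def)
    have "(mat_adjoint Y * Y) $$ (i, j) = of_real (e i) * of_real (e j) * (mat_adjoint N * N) $$ (i, j)"
      using ij N by (auto simp: Y_def scalar_prod_def sum_distrib_left mult_ac)
    also have "\<dots> = mat_diag p (\<lambda>i. if q i = 0 then 0 else 1) $$ (i, j)"
    proof (cases "i = j")
      case True
      have "e i * e i * q i = (if q i = 0 then 0 else 1)"
        using q0[of i] by (auto simp: e_def)
      then show ?thesis using True ij unfolding NN
        by (simp add: mat_diag_def d flip: of_real_mult)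
    qed (use ij in \<open>simp add: NN mat_diag_def\<close>)
    finally show "(mat_adjoint Y * Y) $$ (i, j) = mat_diag p (\<lambda>i. if q i = 0 then 0 else 1) $$ (i, j)" .
  qed (use Y in \<open>auto simp: mat_diag_def\<close>)
  have contr: "vnorm_sq (Y *\<^sub>v v) \<le> vnorm_sq v" if v: "v \<in> carrier_vec p" for v
  proof -
    have "complex_of_real (vnorm_sq (Y *\<^sub>v v)) = v \<bullet>c (mat_adjoint Y *\<^sub>v (Y *\<^sub>v v))"
      unfolding vnorm_sq_cscalar using Y v by (intro cscalar_mat_adjoint) auto
    also have "mat_adjoint Y *\<^sub>v (Y *\<^sub>v v) = mat_diag p (\<lambda>i. if q i = 0 then 0 else 1) *\<^sub>v v"
      using Y v by (subst assoc_mult_mat_vec[symmetric, of _ p n _ p]) (auto simp: YY)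
    also have "\<dots> = vec p (\<lambda>i. if q i = 0 then 0 else v $ i)"
      using v by (intro eq_vecI) (auto simp: mat_diag_def scalar_prod_def if_distrib[of "\<lambda>x. x * _"] cong: if_cong)
    also have "v \<bullet>c \<dots> = of_real (\<Sum>i<p. if q i = 0 then 0 else (cmod (v $ i))\<^sup>2)"
      unfolding of_real_sum using v
      by (auto simp: scalar_prod_def atLeast0LessThan cnj_mult_self mult.assoc mult.left_commute[of _ "complex_of_real _"] intro!: sum.cong)
    finally have "vnorm_sq (Y *\<^sub>v v) = (\<Sum>i<p. if q i = 0 then 0 else (cmod (v $ i))\<^sup>2)"
      using of_real_eq_iff by blast
    also have "\<dots> \<le> (\<Sum>i<p. (cmod (v $ i))\<^sup>2)" by (intro sum_mono) auto
    finally show ?thesis using v by (simp add: vnorm_sq_def)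
  qed
  have row: "(\<Sum>i<p. (cmod (Y $$ (j, i)))\<^sup>2) \<le> (if j \<in> J then 1 else 0)" if j: "j < n" for j
  proof (cases "j \<in> J")
    case True
    have "vnorm_sq (mat_adjoint Y *\<^sub>v unit_vec n j) \<le> vnorm_sq (unit_vec n j)"
      by (rule vnorm_sq_adjoint_contraction[OF Y contr]) auto
    also have "vnorm_sq (unit_vec n j) = 1"
      using j by (auto simp: vnorm_sq_def unit_vec_def if_distrib[of "\<lambda>x. (cmod x)\<^sup>2"] cong: if_cong)
    also have "vnorm_sq (mat_adjoint Y *\<^sub>v unit_vec n j) = (\<Sum>i<p. (cmod (Y $$ (j, i)))\<^sup>2)"
      using Y j by (auto simp: vnorm_sq_def)
    finally show ?thesis using True by simp
  next
    case False
    have "N $$ (j, i) = 0" if "i < p" for i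
      using M W j that zero[OF j False] unfolding N_def by (auto simp: scalar_prod_def)
    then show ?thesis using False j by (simp add: Y_def)
  qed
  have "real (card {i. i < p \<and> q i \<noteq> 0}) = (\<Sum>i<p. vnorm_sq (col Y i))"
  proof -
    have "vnorm_sq (col Y i) = (if q i = 0 then 0 else 1)" if "i < p" for i
    proof -
      have "complex_of_real (vnorm_sq (col Y i)) = (if q i = 0 then 0 else 1)"
        using gram_diagonal[of i Y] Y that by (simp add: YY mat_diag_def)
      then show ?thesis by (auto split: if_splits)
    qed
    then have "(\<Sum>i<p. vnorm_sq (col Y i)) = (\<Sum>i<p. if q i \<noteq> 0 then 1 else 0)"
      by (intro sum.cong) auto
    also have "\<dots> = (\<Sum>i\<in>{..<p} \<inter> {i. q i \<noteq> 0}. 1)"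
      by (subst sum.inter_restrict) auto
    also have "{..<p} \<inter> {i. q i \<noteq> 0} = {i. i < p \<and> q i \<noteq> 0}" by auto
    finally show ?thesis by simp
  qed
  also have "\<dots> = frobenius_sq Y" using Y by (simp add: frobenius_sq_def)
  also have "\<dots> \<le> (\<Sum>j<n. if j \<in> J then 1 else 0)"
    unfolding frobenius_sq_entries using Y row by (auto intro!: sum_mono)
  also have "\<dots> = real (card ({..<n} \<inter> J))"
    by (subst sum.inter_restrict[symmetric]) auto
  also have "\<dots> \<le> real (card J)" using J by (auto intro: card_mono)
  finally have le: "card {i. i < p \<and> q i \<noteq> 0} \<le> card J" by simp
  have eq: "{i. i < p \<and> M *\<^sub>v col W i = 0\<^sub>v n} = {i. i < p \<and> q i = 0}"
  proof -
    have "M *\<^sub>v col W i = 0\<^sub>v n \<longleftrightarrow> q i = 0" if "i < p" for i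
      unfolding q_def N_def using M W that by (subst col_mult2[OF M W(1)]) (auto simp: vnorm_sq_zero_iff[of _ n])
    then show ?thesis by auto
  qed
  have "p = card ({i. i < p \<and> q i = 0} \<union> {i. i < p \<and> q i \<noteq> 0})"
    by (subst card_lessThan[symmetric], rule arg_cong[where f = card]) auto
  also have "\<dots> = card {i. i < p \<and> q i = 0} + card {i. i < p \<and> q i \<noteq> 0}"
    by (rule card_Un_disjoint) auto
  finally have "p \<le> card {i. i < p \<and> M *\<^sub>v col W i = 0\<^sub>v n} + card J"
    using le unfolding eq by simp
  then show ?thesis using that W by blast
qed

text \<open>Let the columns of \<open>U\<close> be right singular vectors whose singular values all lie on the same side of the
  interval. Then every unit vector \<open>v\<close> in their span satisfies \<open>\<bar>|A v| - 1\<bar> \<ge> \<epsilon>\<close>, because \<open>|A v|\<^sup>2\<close> is a convex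
  combination of squared singular values; across both sides such a combination could be \<open>1\<close>.
  Restricting to the kernel of \<open>S\<close> costs at most \<open>card J\<close> dimensions. On what remains \<open>A - 1\<close> is \<open>E + L\<close>, so \<open>|L v| \<ge> \<epsilon> - \<delta>\<close>, and the Frobenius norm of \<open>L\<close> bounds
  the number of orthonormal vectors with this property.\<close>

lemma count_one_side:
  assumes A: "A \<in> carrier_mat n n" and U: "U \<in> carrier_mat n p" "mat_adjoint U * U = 1\<^sub>m p"
    and diag: "mat_adjoint U * (mat_adjoint A * A) * U = mat_diag p (\<lambda>i. complex_of_real (t i))"
    and out: "(\<forall>i<p. (1 + \<epsilon>)\<^sup>2 \<le> t i) \<or> (\<epsilon> \<le> 1 \<and> (\<forall>i<p. t i \<le> (1 - \<epsilon>)\<^sup>2))"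
    and \<delta>: "0 \<le> \<delta>" "\<delta> < \<epsilon>"
    and dec: "A = 1\<^sub>m n + X * S + E + L"
    and X: "X \<in> carrier_mat n n" and S: "S \<in> carrier_mat n n"
    and E: "E \<in> carrier_mat n n" and L: "L \<in> carrier_mat n n"
    and J: "finite J" "\<And>i j. i < n \<Longrightarrow> i \<notin> J \<Longrightarrow> j < n \<Longrightarrow> S $$ (i, j) = 0"
    and op: "\<And>v. v \<in> carrier_vec n \<Longrightarrow> vnorm (E *\<^sub>v v) \<le> \<delta> * vnorm v"
  shows "real p \<le> real (card J) + frobenius_sq L / (\<epsilon> - \<delta>)\<^sup>2"
proof -
  have SU: "S * U \<in> carrier_mat n p" using S U by auto
  have "(S * U) $$ (i, j) = 0" if "i < n" "i \<notin> J" "j < p" for i j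
    using that S U J(2)[OF that(1,2)] by (auto simp: scalar_prod_def)
  then obtain W where W: "W \<in> carrier_mat p p" "mat_adjoint W * W = 1\<^sub>m p"
    "p \<le> card {i. i < p \<and> (S * U) *\<^sub>v col W i = 0\<^sub>v n} + card J"
    using kernel_columns[OF SU J(1), of thesis] by blast
  define Z where "Z = {i. i < p \<and> (S * U) *\<^sub>v col W i = 0\<^sub>v n}"
  define V where "V = U * W"
  have V: "V \<in> carrier_mat n p" using U W unfolding V_def by auto
  have VV: "mat_adjoint V * V = 1\<^sub>m p"
  proof -
    have "mat_adjoint V * V = mat_adjoint W * ((mat_adjoint U * U) * W)"
      unfolding V_def mat_adjoint_mult[OF U(1) W(1)] 
      by (simp add: mat_assoc carrier_matD[OF U(1)] carrier_matD[OF W(1)])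
    then show ?thesis using U W by simp
  qed
  have low: "(\<epsilon> - \<delta>)\<^sup>2 \<le> vnorm_sq (col (L * V) i)" if i: "i \<in> Z" for i
  proof -
    have ip: "i < p" using i unfolding Z_def by simp
    define w where "w = col W i"
    define v where "v = U *\<^sub>v w"
    have w: "w \<in> carrier_vec p" using W ip unfolding w_def by auto
    have v: "v \<in> carrier_vec n" using U w unfolding v_def by auto
    have vcol: "v = col V i"
      unfolding v_def w_def V_def using U W ip by (subst col_mult2) auto
    have w1: "vnorm_sq w = 1"
    proof -
      have "complex_of_real (vnorm_sq w) = 1"
        using gram_diagonal[of i W] W ip unfolding w_def by simp
      then show ?thesis by simp
    qed
    have v1: "vnorm v = 1"
      unfolding vnorm_def v_def using vnorm_sq_mult_isometry[OF U w] w1 by simp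
    have Sv: "S *\<^sub>v v = 0\<^sub>v n"
      using i S U w unfolding Z_def v_def w_def by (auto simp: assoc_mult_mat_vec[OF S U(1)])
    have "complex_of_real (vnorm_sq (A *\<^sub>v v)) = w \<bullet>c (mat_adjoint (A * U) *\<^sub>v ((A * U) *\<^sub>v w))"
      using cscalar_mat_adjoint[of "A * U" n p w "(A * U) *\<^sub>v w"] A U w
      unfolding vnorm_sq_cscalar v_def by (simp add: assoc_mult_mat_vec[OF A U(1) w])
    also have "mat_adjoint (A * U) *\<^sub>v ((A * U) *\<^sub>v w) = (mat_adjoint (A * U) * (A * U)) *\<^sub>v w"
      using A U w by (subst assoc_mult_mat_vec[of _ p n _ p]) auto
    also have "mat_adjoint (A * U) * (A * U) = mat_adjoint U * (mat_adjoint A * A) * U"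
      unfolding mat_adjoint_mult[OF A U(1)] 
      by (simp add: mat_assoc carrier_matD[OF A] carrier_matD[OF U(1)])
    also have "\<dots> *\<^sub>v w = vec p (\<lambda>i. of_real (t i) * w $ i)"
      unfolding diag using w by (intro eq_vecI) (auto simp: mat_diag_def scalar_prod_def if_distrib[of "\<lambda>x. x * _"] cong: if_cong)
    also have "w \<bullet>c \<dots> = of_real (\<Sum>k<p. t k * (cmod (w $ k))\<^sup>2)"
      unfolding of_real_sum using w
      by (auto simp: scalar_prod_def atLeast0LessThan cnj_mult_self mult.assoc mult.left_commute[of _ "complex_of_real _"] intro!: sum.cong)
    finally have Av: "vnorm_sq (A *\<^sub>v v) = (\<Sum>k<p. t k * (cmod (w $ k))\<^sup>2)"
      using of_real_eq_iff by blast
    have one: "(\<Sum>k<p. (cmod (w $ k))\<^sup>2) = 1" using w1 w by (simp add: vnorm_sq_def)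
    have AvE: "A *\<^sub>v v = v + E *\<^sub>v v + L *\<^sub>v v"
    proof -
      have "A *\<^sub>v v = 1\<^sub>m n *\<^sub>v v + X *\<^sub>v (S *\<^sub>v v) + E *\<^sub>v v + L *\<^sub>v v"
        unfolding dec using X S E L v
        by (simp add: add_mult_distrib_mat_vec[of _ n n] assoc_mult_mat_vec[of _ n n _ n])
      also have "X *\<^sub>v (S *\<^sub>v v) = 0\<^sub>v n" unfolding Sv using X by auto
      finally show ?thesis using v E L by simp
    qed
    have Ev: "E *\<^sub>v v \<in> carrier_vec n" and Lv: "L *\<^sub>v v \<in> carrier_vec n" using E L v by auto
    have up: "vnorm (A *\<^sub>v v) \<le> 1 + \<delta> + vnorm (L *\<^sub>v v)"
      unfolding AvE using vnorm_triangle[of "v + E *\<^sub>v v" n "L *\<^sub>v v"] vnorm_triangle[OF v Ev] op[OF v] v1 v Ev Lv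
      by simp
    have lo: "1 \<le> vnorm (A *\<^sub>v v) + \<delta> + vnorm (L *\<^sub>v v)"
    proof -
      have "v = (v + e + l) + (- e + - l)" if "e \<in> carrier_vec n" "l \<in> carrier_vec n" for e l
        using v that by (intro eq_vecI) auto
      from this[OF Ev Lv] have "v = A *\<^sub>v v + (- (E *\<^sub>v v) + - (L *\<^sub>v v))"
        unfolding AvE .
      then have "vnorm v \<le> vnorm (A *\<^sub>v v) + vnorm (- (E *\<^sub>v v) + - (L *\<^sub>v v))"
        using vnorm_triangle[of "A *\<^sub>v v" n "- (E *\<^sub>v v) + - (L *\<^sub>v v)"] A v Ev Lv by simp
      also have "vnorm (- (E *\<^sub>v v) + - (L *\<^sub>v v)) \<le> vnorm (E *\<^sub>v v) + vnorm (L *\<^sub>v v)"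
        using vnorm_triangle[of "- (E *\<^sub>v v)" n "- (L *\<^sub>v v)"] Ev Lv by (simp add: vnorm_uminus)
      finally show ?thesis using op[OF v] v1 by simp
    qed
    have "\<epsilon> - \<delta> \<le> vnorm (L *\<^sub>v v)"
      using out
    proof
      assume t: "\<forall>i<p. (1 + \<epsilon>)\<^sup>2 \<le> t i"
      have "(\<Sum>k<p. (1 + \<epsilon>)\<^sup>2 * (cmod (w $ k))\<^sup>2) \<le> vnorm_sq (A *\<^sub>v v)"
        unfolding Av using t by (intro sum_mono mult_right_mono) auto
      then have "(1 + \<epsilon>)\<^sup>2 \<le> vnorm_sq (A *\<^sub>v v)" using one by (simp flip: sum_distrib_left)
      then have "1 + \<epsilon> \<le> vnorm (A *\<^sub>v v)" unfolding vnorm_def by (rule real_le_rsqrt)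
      then show ?thesis using up by simp
    next
      assume t: "\<epsilon> \<le> 1 \<and> (\<forall>i<p. t i \<le> (1 - \<epsilon>)\<^sup>2)"
      have "vnorm_sq (A *\<^sub>v v) \<le> (\<Sum>k<p. (1 - \<epsilon>)\<^sup>2 * (cmod (w $ k))\<^sup>2)"
        unfolding Av using t by (intro sum_mono mult_right_mono) auto
      then have "vnorm_sq (A *\<^sub>v v) \<le> (1 - \<epsilon>)\<^sup>2" using one by (simp flip: sum_distrib_left)
      then have "vnorm (A *\<^sub>v v) \<le> 1 - \<epsilon>" unfolding vnorm_def using t by (intro real_le_lsqrt) auto
      then show ?thesis using lo by simp
    qed
    then have "(\<epsilon> - \<delta>)\<^sup>2 \<le> (vnorm (L *\<^sub>v v))\<^sup>2" using \<delta> by (intro power_mono) auto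
    also have "\<dots> = vnorm_sq (col (L * V) i)"
      using L V ip unfolding vnorm_def vcol by (subst col_mult2) auto
    finally show ?thesis .
  qed
  have "real (card Z) * (\<epsilon> - \<delta>)\<^sup>2 = (\<Sum>i\<in>Z. (\<epsilon> - \<delta>)\<^sup>2)" by simp
  also have "\<dots> \<le> (\<Sum>i\<in>Z. vnorm_sq (col (L * V) i))" by (rule sum_mono) (rule low)
  also have "\<dots> \<le> (\<Sum>i<p. vnorm_sq (col (L * V) i))"
    by (intro sum_mono2) (auto simp: Z_def)
  also have "\<dots> = frobenius_sq (L * V)" using V by (simp add: frobenius_sq_def)
  also have "\<dots> \<le> frobenius_sq L" by (rule frobenius_sq_mult_isometry_le[OF V VV L])
  finally have "real (card Z) \<le> frobenius_sq L / (\<epsilon> - \<delta>)\<^sup>2" using \<delta> by (simp add: pos_le_divide_eq)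
  moreover have "real p \<le> real (card Z) + real (card J)"
    using W(3) unfolding Z_def by linarith
  ultimately show ?thesis by linarith
qed

lemma num_outside_le:
  assumes A: "A \<in> carrier_mat n n" and \<delta>: "0 \<le> \<delta>" "\<delta> < \<epsilon>"
    and dec: "A = 1\<^sub>m n + X * S + E + L"
    and X: "X \<in> carrier_mat n n" and S: "S \<in> carrier_mat n n"
    and E: "E \<in> carrier_mat n n" and L: "L \<in> carrier_mat n n"
    and J: "finite J" "\<And>i j. i < n \<Longrightarrow> i \<notin> J \<Longrightarrow> j < n \<Longrightarrow> S $$ (i, j) = 0"
    and op: "\<And>v. v \<in> carrier_vec n \<Longrightarrow> vnorm (E *\<^sub>v v) \<le> \<delta> * vnorm v"
  shows "real (num_outside {1 - \<epsilon>..1 + \<epsilon>} A) \<le> 2 * (real (card J) + frobenius_sq L / (\<epsilon> - \<delta>)\<^sup>2)"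
proof -
  obtain U t where U: "U \<in> carrier_mat n n" "mat_adjoint U * U = 1\<^sub>m n"
    and diag: "mat_adjoint U * (mat_adjoint A * A) * U = mat_diag n (\<lambda>i. complex_of_real (t i))"
    and t: "\<And>i. i < n \<Longrightarrow> t i \<ge> 0"
    and num: "\<And>S. num_outside S A = card {i. i < n \<and> sqrt (t i) \<notin> S}"
    by (rule num_outside_singular_vectors[OF A]) blast
  have side: "real (card I) \<le> real (card J) + frobenius_sq L / (\<epsilon> - \<delta>)\<^sup>2"
    if I: "I \<subseteq> {..<n}" and out: "(\<forall>i\<in>I. (1 + \<epsilon>)\<^sup>2 \<le> t i) \<or> (\<epsilon> \<le> 1 \<and> (\<forall>i\<in>I. t i \<le> (1 - \<epsilon>)\<^sup>2))" for I
  proof -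
    have "finite I" using I finite_subset by blast
    then obtain e where e: "bij_betw e {..<card I} I"
      using ex_bij_betw_nat_finite[of I] by (auto simp: atLeast0LessThan)
    define p where "p = card I"
    have eI: "e i \<in> I" "e i < n" if "i < p" for i using e I that unfolding p_def bij_betw_def by auto
    have einj: "e i = e j \<longleftrightarrow> i = j" if "i < p" "j < p" for i j
      using e that unfolding p_def bij_betw_def inj_on_def by auto
    define T where "T = Matrix.mat n p (\<lambda>(j, i). if j = e i then 1 else (0::complex))"
    have T: "T \<in> carrier_mat n p" by (simp add: T_def)
    have TDT: "mat_adjoint T * (mat_diag n d * T) = mat_diag p (\<lambda>i. d (e i))" for d
    proof (rule eq_matI)
      fix i j assume "i < dim_row (mat_diag p (\<lambda>i. d (e i)))" "j < dim_col (mat_diag p (\<lambda>i. d (e i)))"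
      then have ij: "i < p" "j < p" by (auto simp: mat_diag_def)
      have "mat_diag n d * T = Matrix.mat n p (\<lambda>(k, i). if k = e i then d k else 0)"
        using T by (subst mat_diag_mult_left[of _ n p]) (auto simp: T_def)
      then show "(mat_adjoint T * (mat_diag n d * T)) $$ (i, j) = mat_diag p (\<lambda>i. d (e i)) $$ (i, j)"
        using ij eI einj by (auto simp: scalar_prod_def T_def mat_diag_def if_distrib[of cnj] if_distrib[of "\<lambda>x. x * _"] cong: if_cong)
    qed (auto simp: T_def mat_diag_def)
    have TT: "mat_adjoint T * T = 1\<^sub>m p"
      using TDT[of "\<lambda>_. 1"] T by simp
    have UT: "U * T \<in> carrier_mat n p" using U T by auto
    have adj: "mat_adjoint (U * T) = mat_adjoint T * mat_adjoint U" using mat_adjoint_mult[OF U(1) T] .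
    have "mat_adjoint (U * T) * (U * T) = mat_adjoint T * ((mat_adjoint U * U) * T)"
      unfolding adj 
      by (simp add: mat_assoc carrier_matD[OF U(1)] carrier_matD[OF T])
    then have 1: "mat_adjoint (U * T) * (U * T) = 1\<^sub>m p" using U T TT by simp
    have G: "mat_adjoint A * A \<in> carrier_mat n n" using A by auto
    have "mat_adjoint (U * T) * (mat_adjoint A * A) * (U * T)
        = mat_adjoint T * ((mat_adjoint U * (mat_adjoint A * A) * U) * T)"
      unfolding adj 
      by (simp add: mat_assoc carrier_matD[OF U(1)] carrier_matD[OF T] carrier_matD[OF A])
    then have 2: "mat_adjoint (U * T) * (mat_adjoint A * A) * (U * T) = mat_diag p (\<lambda>i. complex_of_real (t (e i)))"
      unfolding diag TDT .
    show ?thesis unfolding p_def[symmetric]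
      by (rule count_one_side[OF A UT 1 2 _ \<delta> dec X S E L J op]) (use out eI in auto)
  qed
  define hi where "hi = {i. i < n \<and> 1 + \<epsilon> < sqrt (t i)}"
  define lo where "lo = {i. i < n \<and> sqrt (t i) < 1 - \<epsilon>}"
  have "{i. i < n \<and> sqrt (t i) \<notin> {1 - \<epsilon>..1 + \<epsilon>}} = hi \<union> lo"
    unfolding hi_def lo_def by auto
  then have "num_outside {1 - \<epsilon>..1 + \<epsilon>} A \<le> card hi + card lo"
    unfolding num by (simp add: card_Un_le)
  moreover have "real (card hi) \<le> real (card J) + frobenius_sq L / (\<epsilon> - \<delta>)\<^sup>2"
  proof (rule side)
    have "(1 + \<epsilon>)\<^sup>2 \<le> t i" if "i \<in> hi" for i
    proof -
      have "(1 + \<epsilon>)\<^sup>2 \<le> (sqrt (t i))\<^sup>2" using that \<delta> unfolding hi_def by (intro power_mono) auto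
      then show ?thesis using t that unfolding hi_def by simp
    qed
    then show "(\<forall>i\<in>hi. (1 + \<epsilon>)\<^sup>2 \<le> t i) \<or> (\<epsilon> \<le> 1 \<and> (\<forall>i\<in>hi. t i \<le> (1 - \<epsilon>)\<^sup>2))" by blast
  qed (auto simp: hi_def)
  moreover have "real (card lo) \<le> real (card J) + frobenius_sq L / (\<epsilon> - \<delta>)\<^sup>2"
  proof (cases "lo = {}")
    case True
    then show ?thesis by simp
  next
    case False
    have "t i \<le> (1 - \<epsilon>)\<^sup>2 \<and> \<epsilon> \<le> 1" if "i \<in> lo" for i
    proof -
      have s: "0 \<le> sqrt (t i)" "sqrt (t i) < 1 - \<epsilon>" and ti: "0 \<le> t i"
        using that t unfolding lo_def by auto
      have "\<epsilon> \<le> 1" using s by linarith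
      moreover have "(sqrt (t i))\<^sup>2 \<le> (1 - \<epsilon>)\<^sup>2" using s by (intro power_mono) auto
      ultimately show ?thesis using ti by simp
    qed
    then show ?thesis using False by (intro side) (auto simp: lo_def)
  qed
  moreover have "real (num_outside {1 - \<epsilon>..1 + \<epsilon>} A) \<le> real (card hi) + real (card lo)"
    using calculation(1) by (metis of_nat_add of_nat_mono)
  ultimately show ?thesis unfolding distrib_left by linarith
qed

section \<open>Fourier modes\<close>

definition fourier_mode :: "int \<Rightarrow> real \<Rightarrow> complex" where
  "fourier_mode m x = exp (\<i> * of_int m * of_real x)"

lemma fourier_mode_cis: "fourier_mode m x = cis (of_int m * x)"
  unfolding fourier_mode_def cis_conv_exp by (simp add: mult.assoc)

lemma fourier_mode_0 [simp]: "fourier_mode 0 x = 1" "fourier_mode m 0 = 1"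
  by (simp_all add: fourier_mode_cis)

lemma norm_fourier_mode [simp]: "cmod (fourier_mode m x) = 1"
  by (simp add: fourier_mode_cis)

lemma fourier_mode_mult: "fourier_mode m x * fourier_mode k x = fourier_mode (m + k) x"
  by (simp add: fourier_mode_cis cis_mult ring_distribs)

lemma fourier_mode_add: "fourier_mode m (x + y) = fourier_mode m x * fourier_mode m y"
  by (simp add: fourier_mode_cis cis_mult ring_distribs)

lemma cnj_fourier_mode: "cnj (fourier_mode m x) = fourier_mode (- m) x"
  by (simp add: fourier_mode_cis cis_cnj)

lemma fourier_mode_2pi [simp]: "fourier_mode m (2 * pi) = 1"
proof -
  have "cis (2 * pi * of_int m) = 1" by (rule cis_multiple_2pi) simp
  then show ?thesis by (simp add: fourier_mode_cis mult_ac)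
qed

lemma fourier_mode_periodic: "fourier_mode m (x + 2 * pi) = fourier_mode m x"
  by (simp add: fourier_mode_add)

lemma fourier_mode_power: "fourier_mode m (2 * pi * real q / real n) = fourier_mode m (2 * pi / real n) ^ q"
  by (simp add: fourier_mode_cis Complex.DeMoivre mult_ac)

lemma continuous_fourier_mode [continuous_intros]: "continuous_on A (fourier_mode m)"
  unfolding fourier_mode_def by (intro continuous_intros)

lemma norm_fourier_mode_diff: "cmod (fourier_mode m x - fourier_mode m y) \<le> \<bar>of_int m\<bar> * \<bar>x - y\<bar>"
proof -
  have "fourier_mode m x - fourier_mode m y = fourier_mode m y * (fourier_mode m (x - y) - 1)"
    using fourier_mode_add[of m y "x - y"] by (simp add: ring_distribs)
  then have "cmod (fourier_mode m x - fourier_mode m y) = cmod (exp (\<i> * of_real (of_int m * (x - y))) - 1)"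
    by (simp add: norm_mult) (simp add: fourier_mode_def mult.assoc)
  also have "\<dots> = 2 * \<bar>sin (of_int m * (x - y) / 2)\<bar>" by (rule dist_exp_i_1)
  also have "\<dots> \<le> 2 * \<bar>of_int m * (x - y) / 2\<bar>" by (intro mult_left_mono abs_sin_x_le_abs_x) auto
  finally show ?thesis by (simp add: abs_mult)
qed

lemma has_integral_fourier_mode:
  assumes "m \<noteq> 0" "a \<le> b"
  shows "(fourier_mode m has_integral (fourier_mode m b - fourier_mode m a) / (\<i> * of_int m)) {a..b}"
proof -
  have "((\<lambda>x. fourier_mode m x / (\<i> * of_int m)) has_vector_derivative fourier_mode m x) (at x within {a..b})" for x
  proof -
    have "((\<lambda>x. exp (\<i> * of_int m * x)) has_field_derivative \<i> * of_int m * exp (\<i> * of_int m * complex_of_real x)) (at (of_real x))"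
      by (auto intro!: derivative_eq_intros)
    from has_vector_derivative_real_field[OF this]
    have "(fourier_mode m has_vector_derivative \<i> * of_int m * fourier_mode m x) (at x within {a..b})"
      by (simp add: fourier_mode_def[abs_def])
    from has_vector_derivative_divide[OF this, of "\<i> * of_int m"] show ?thesis using assms by simp
  qed
  from fundamental_theorem_of_calculus[OF assms(2) this] show ?thesis
    by (simp add: diff_divide_distrib)
qed

text \<open>A weak form of the inequality of Jordan. The cubic Taylor bound suffices because
  \<open>(pi / 2)\<^sup>2 < 3\<close>.\<close>

lemma sin_ge_half:
  assumes "0 \<le> u" "u \<le> pi / 2" shows "u / 2 \<le> sin u"
proof -
  have "\<bar>sin u - (\<Sum>m<3. sin_coeff m * u ^ m)\<bar> \<le> inverse (fact 3) * \<bar>u\<bar> ^ 3"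
    by (rule Maclaurin_sin_bound)
  then have "\<bar>sin u - u\<bar> \<le> u ^ 3 / 6"
    using assms by (simp add: numeral_eq_Suc sin_coeff_def lessThan_Suc field_simps)
  then have 1: "u - sin u \<le> u ^ 3 / 6" by linarith
  have "pi \<le> 3.2" using pi_approx(2) by simp
  then have "u \<le> 1.7" using assms by linarith
  then have "u * u \<le> 3" using mult_mono[of u "1.7" u "1.7"] assms by simp
  then have "u * (u * u) \<le> u * 3" using assms by (intro mult_left_mono) auto
  then show ?thesis using 1 by (simp add: power3_eq_cube mult.assoc)
qed

lemma norm_cis_minus_one_ge:
  assumes "\<bar>\<theta>\<bar> \<le> pi" shows "\<bar>\<theta>\<bar> / 2 \<le> cmod (1 - cis \<theta>)"
proof -
  have "cmod (1 - cis \<theta>) = 2 * \<bar>sin (\<theta> / 2)\<bar>"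
    using dist_exp_i_1[of \<theta>] by (simp add: cis_conv_exp norm_minus_commute)
  also have "\<bar>sin (\<theta> / 2)\<bar> = \<bar>sin (\<bar>\<theta>\<bar> / 2)\<bar>" by (cases "\<theta> \<ge> 0") auto
  finally show ?thesis using sin_ge_half[of "\<bar>\<theta>\<bar> / 2"] assms by linarith
qed

lemma cis_remainder: "cmod (cis \<theta> - 1 - \<i> * of_real \<theta>) \<le> \<theta>\<^sup>2"
proof -
  have "\<bar>sin \<theta> - (\<Sum>m<2. sin_coeff m * \<theta> ^ m)\<bar> \<le> inverse (fact 2) * \<bar>\<theta>\<bar> ^ 2"
    by (rule Maclaurin_sin_bound)
  then have im: "\<bar>sin \<theta> - \<theta>\<bar> \<le> \<theta>\<^sup>2 / 2"
    by (simp add: numeral_eq_Suc sin_coeff_def lessThan_Suc field_simps)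
  have "1 - cos \<theta> = 2 * (sin (\<theta> / 2))\<^sup>2"
    using cos_double_sin[of "\<theta> / 2"] by simp
  moreover have "(sin (\<theta> / 2))\<^sup>2 \<le> (\<theta> / 2)\<^sup>2"
    using abs_sin_x_le_abs_x[of "\<theta> / 2"] by (simp only: abs_le_square_iff)
  ultimately have re: "\<bar>cos \<theta> - 1\<bar> \<le> \<theta>\<^sup>2 / 2" by (simp add: power_divide)
  show ?thesis
    using cmod_le[of "cis \<theta> - 1 - \<i> * of_real \<theta>"] re im by simp
qed

text \<open>At the frequency \<open>l\<close>, with \<open>\<theta> = - 2 * pi * l / n\<close>, the quantities \<open>1 / (1 - cis \<theta>)\<close> and
  \<open>- 1 / (\<i> * \<theta>)\<close> are, up to the factor \<open>n\<close>, the kernels of the sampled and of the exact Fourier coefficients of a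
  jump. They have the same pole at zero, so their difference stays bounded.\<close>

lemma inverse_remainder:
  assumes "\<theta> \<noteq> 0" "\<bar>\<theta>\<bar> \<le> pi"
  shows "cmod (1 / (1 - cis \<theta>) + 1 / (\<i> * of_real \<theta>)) \<le> 2"
proof -
  have ge: "\<bar>\<theta>\<bar> / 2 \<le> cmod (1 - cis \<theta>)" using assms(2) by (rule norm_cis_minus_one_ge)
  have ne: "1 - cis \<theta> \<noteq> 0" using ge assms by auto
  have "1 / (1 - cis \<theta>) + 1 / (\<i> * of_real \<theta>) = - (cis \<theta> - 1 - \<i> * of_real \<theta>) / ((1 - cis \<theta>) * (\<i> * of_real \<theta>))"
    using ne assms by (simp add: divide_simps)
  then have "cmod (1 / (1 - cis \<theta>) + 1 / (\<i> * of_real \<theta>)) = cmod (cis \<theta> - 1 - \<i> * of_real \<theta>) / (cmod (1 - cis \<theta>) * \<bar>\<theta>\<bar>)"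
    by (simp only: norm_divide norm_mult norm_minus_cancel) simp
  also have "\<dots> \<le> \<theta>\<^sup>2 / (\<bar>\<theta>\<bar> / 2 * \<bar>\<theta>\<bar>)"
  proof (intro frac_le cis_remainder mult_right_mono)
    show "0 < \<bar>\<theta>\<bar> / 2 * \<bar>\<theta>\<bar>" using assms(1) by (intro mult_pos_pos) auto
  qed (use ge in auto)
  also have "\<dots> = 2" using assms by (simp add: power2_eq_square)
  finally show ?thesis .
qed

section \<open>Sampled and exact Fourier coefficients\<close>

text \<open>The period \<open>{0..2 * pi}\<close> is used because it contains the grid \<open>2 * pi * q / n\<close> at which the
  circulant matrix samples its symbol.\<close>

definition fourier_coeff :: "(real \<Rightarrow> complex) \<Rightarrow> int \<Rightarrow> complex" where
  "fourier_coeff \<phi> l = 1 / (2 * pi) * integral {0..2 * pi} (\<lambda>x. \<phi> x * fourier_mode (- l) x)"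

text \<open>The Riemann sum for the Fourier coefficient over the grid; these are the entries of the circulant
  matrix, see \<open>circulant_entry\<close> below.\<close>

definition dft_coeff :: "nat \<Rightarrow> (real \<Rightarrow> complex) \<Rightarrow> int \<Rightarrow> complex" where
  "dft_coeff n \<phi> l = 1 / of_nat n * (\<Sum>q<n. \<phi> (2 * pi * real q / real n) * fourier_mode (- l) (2 * pi * real q / real n))"

lemma grid_points_in_interval:
  assumes ab: "0 \<le> a" "a \<le> b" "b \<le> 2 * pi" and n: "n > 0"
  obtains q0 q1 where "q0 \<le> q1" "q1 \<le> n"
    "\<bar>2 * pi * real q0 / real n - a\<bar> \<le> 2 * pi / real n"
    "\<bar>2 * pi * real q1 / real n - b\<bar> \<le> 2 * pi / real n"
    "\<And>q. q < n \<Longrightarrow> 2 * pi * real q / real n \<in> {a..b} \<longleftrightarrow> q0 \<le> q \<and> q < q1"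
proof -
  define s where "s = real n / (2 * pi)"
  have s: "s > 0" using n by (simp add: s_def)
  have pt: "2 * pi * real q / real n = real q / s" for q using n by (simp add: s_def)
  have gap: "2 * pi / real n = 1 / s" using n by (simp add: s_def)
  have bn: "b * s \<le> real n" "0 \<le> a * s" "a * s \<le> b * s"
    using ab s n by (auto simp: s_def field_simps)
  define q0 where "q0 = nat \<lceil>a * s\<rceil>"
  define q1 where "q1 = min n (nat \<lfloor>b * s\<rfloor> + 1)"
  have q0: "a * s \<le> real q0" "real q0 < a * s + 1" using bn unfolding q0_def by linarith+
  have fl: "real (nat \<lfloor>b * s\<rfloor>) \<le> b * s" "b * s < real (nat \<lfloor>b * s\<rfloor>) + 1" using bn by linarith+
  have "q0 \<le> n" unfolding q0_def using bn by linarith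
  moreover have "real q0 < real (nat \<lfloor>b * s\<rfloor>) + 2" using q0(2) bn(3) fl(2) by linarith
  then have "q0 \<le> nat \<lfloor>b * s\<rfloor> + 1" by linarith
  ultimately have "q0 \<le> q1" unfolding q1_def by simp
  moreover have "q1 \<le> n" unfolding q1_def by simp
  moreover have "\<bar>real q0 / s - a\<bar> \<le> 1 / s"
  proof -
    have "real q0 / s - a = (real q0 - a * s) / s" using s by (simp add: field_simps)
    moreover have "\<bar>(real q0 - a * s) / s\<bar> \<le> 1 / s"
      using q0 s by (simp add: divide_right_mono)
    ultimately show ?thesis by simp
  qed
  moreover have "\<bar>real q1 / s - b\<bar> \<le> 1 / s"
  proof -
    have "\<bar>real q1 - b * s\<bar> \<le> 1"
    proof (cases "n \<le> nat \<lfloor>b * s\<rfloor> + 1")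
      case True
      then have "q1 = n" "real n \<le> real (nat \<lfloor>b * s\<rfloor>) + 1" by (auto simp: q1_def)
      then show ?thesis using fl(1) bn(1) by linarith
    next
      case False
      then have "real q1 = real (nat \<lfloor>b * s\<rfloor>) + 1" by (auto simp: q1_def)
      then show ?thesis using fl by linarith
    qed
    then have "\<bar>(real q1 - b * s) / s\<bar> \<le> 1 / s"
      using s by (simp add: divide_right_mono)
    moreover have "real q1 / s - b = (real q1 - b * s) / s" using s by (simp add: field_simps)
    ultimately show ?thesis by simp
  qed
  moreover have "real q / s \<in> {a..b} \<longleftrightarrow> q0 \<le> q \<and> q < q1" if "q < n" for q
  proof -
    have "a \<le> real q / s \<longleftrightarrow> q0 \<le> q"
      unfolding q0_def nat_ceiling_le_eq using s by (simp add: field_simps)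
    moreover have "real q / s \<le> b \<longleftrightarrow> real q \<le> b * s" using s by (simp add: field_simps)
    moreover have "real q \<le> b * s \<longleftrightarrow> q < nat \<lfloor>b * s\<rfloor> + 1" using fl by linarith
    ultimately show ?thesis using that unfolding q1_def by auto
  qed
  ultimately show ?thesis using that[of q0 q1] unfolding pt gap by blast
qed

lemma minus_diff_divide: "- ((x - y) / c) = (y - x) / (c :: complex)"
  by (simp add: diff_divide_distrib)

lemma fourier_coeff_indicator:
  assumes "0 \<le> a" "a \<le> b" "b \<le> 2 * pi"
  shows "fourier_coeff (indicator {a..b}) l =
    (if l = 0 then of_real (b - a) / (2 * pi)
     else (fourier_mode (- l) a - fourier_mode (- l) b) / (2 * pi * \<i> * of_int l))"
proof -
  have "((\<lambda>x. if x \<in> {a..b} then fourier_mode (- l) x else 0) has_integral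
    (if l = 0 then of_real (b - a) else (fourier_mode (- l) a - fourier_mode (- l) b) / (\<i> * of_int l))) {0..2 * pi}"
  proof (subst has_integral_restrict)
    show "{a..b} \<subseteq> {0..2 * pi}" using assms by auto
    show "(fourier_mode (- l) has_integral
      (if l = 0 then of_real (b - a) else (fourier_mode (- l) a - fourier_mode (- l) b) / (\<i> * of_int l))) {a..b}"
    proof (cases "l = 0")
      case True
      have "((\<lambda>x. 1 :: complex) has_integral (b - a) *\<^sub>R 1) {a..b}"
        using has_integral_const_real[of "1::complex" a b] assms by simp
      moreover have "fourier_mode 0 = (\<lambda>x. 1)" by (rule ext) simp
      ultimately show ?thesis using True by (simp add: scaleR_conv_of_real)
    next
      case False
      then show ?thesis using has_integral_fourier_mode[of "- l" a b] assms
        by (simp add: minus_diff_divide)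
    qed
  qed
  moreover have "(\<lambda>x. if x \<in> {a..b} then fourier_mode (- l) x else 0) = (\<lambda>x. indicator {a..b} x * fourier_mode (- l) x)"
    by (auto simp: indicator_def)
  ultimately show ?thesis unfolding fourier_coeff_def by (simp add: integral_unique)
qed

lemma geometric_sum_times:
  fixes z :: complex
  assumes "q0 \<le> q1"
  shows "(\<Sum>q=q0..<q1. z ^ q) * (1 - z) = z ^ q0 - z ^ q1"
  using assms
proof (induction rule: dec_induct)
  case (step n)
  then have "(\<Sum>q=q0..<Suc n. z ^ q) * (1 - z) = (\<Sum>q=q0..<n. z ^ q) * (1 - z) + z ^ n * (1 - z)"
    by (simp add: distrib_right)
  then show ?case unfolding step.IH by (simp add: algebra_simps)
qed simp

text \<open>Summing a geometric series, respectively integrating, expresses both coefficients by the values of the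
  mode at the endpoints.
  At low frequency the two kernels differ by a bounded amount and the endpoints move by at most one
  grid step, which gives an error of order \<open>1 / n\<close>. At high frequency the sampled coefficient
  is \<open>n\<close>-periodic in \<open>l\<close>, so it is as large as at the distance \<open>n - \<bar>l\<bar>\<close> from
  zero, and the error is of that order.\<close>

lemma coeff_error_indicator:
  assumes ab: "0 \<le> a" "a \<le> b" "b \<le> 2 * pi" and l: "\<bar>l\<bar> < int n"
  shows "cmod (dft_coeff n (indicator {a..b}) l - fourier_coeff (indicator {a..b}) l)
    \<le> (if 2 * \<bar>l\<bar> \<le> int n then 6 / real n else 6 / (real n - \<bar>of_int l\<bar>))"
proof -
  have n: "n > 0" using l by auto
  obtain q0 q1 where q: "q0 \<le> q1" "q1 \<le> n"
    "\<bar>2 * pi * real q0 / real n - a\<bar> \<le> 2 * pi / real n"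
    "\<bar>2 * pi * real q1 / real n - b\<bar> \<le> 2 * pi / real n"
    "\<And>q. q < n \<Longrightarrow> 2 * pi * real q / real n \<in> {a..b} \<longleftrightarrow> q0 \<le> q \<and> q < q1"
    using grid_points_in_interval[OF ab n] by blast
  define z where "z = fourier_mode (- l) (2 * pi / real n)"
  have dft: "dft_coeff n (indicator {a..b}) l = (\<Sum>q=q0..<q1. z ^ q) / of_nat n"
  proof -
    have "(\<Sum>q<n. indicator {a..b} (2 * pi * real q / real n) * fourier_mode (- l) (2 * pi * real q / real n))
       = (\<Sum>q<n. if q \<in> {q0..<q1} then z ^ q else 0)"
      by (intro sum.cong) (auto simp: indicator_def q(5) z_def fourier_mode_power simp del: atLeastAtMost_iff)
    also have "\<dots> = (\<Sum>q\<in>{..<n} \<inter> {q0..<q1}. z ^ q)"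
      by (subst sum.inter_restrict) auto
    also have "{..<n} \<inter> {q0..<q1} = {q0..<q1}" using q(2) by auto
    finally show ?thesis unfolding dft_coeff_def by simp
  qed
  show ?thesis
  proof (cases "l = 0")
    case True
    have "dft_coeff n (indicator {a..b}) l - fourier_coeff (indicator {a..b}) l
       = of_real ((real q1 - real q0) / real n - (b - a) / (2 * pi))"
      unfolding dft fourier_coeff_indicator[OF ab] using True q(1) by (simp add: z_def of_nat_diff)
    also have "(real q1 - real q0) / real n - (b - a) / (2 * pi)
       = ((2 * pi * real q1 / real n - b) - (2 * pi * real q0 / real n - a)) / (2 * pi)"
      using n by (simp add: field_simps)
    also have "cmod (of_real \<dots>) \<le> (2 * pi / real n + 2 * pi / real n) / (2 * pi)"
      using q(3,4) unfolding norm_of_real abs_divide by (intro divide_mono) auto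
    also have "\<dots> \<le> 6 / real n" using n by (simp add: field_simps)
    finally show ?thesis using True by simp
  next
    case False
    define \<theta> where "\<theta> = - (2 * pi * of_int l / real n)"
    have zc: "z = cis \<theta>" unfolding z_def \<theta>_def fourier_mode_cis by (simp add: mult_ac)
    have nth: "of_nat n * (\<i> * of_real \<theta>) = - (2 * pi * \<i> * of_int l)" using n by (simp add: \<theta>_def)
    have fc: "fourier_coeff (indicator {a..b}) l = - (fourier_mode (- l) a - fourier_mode (- l) b) / (of_nat n * (\<i> * of_real \<theta>))"
      unfolding fourier_coeff_indicator[OF ab] nth using False by (simp add: minus_diff_divide)
    have zq: "z ^ q = fourier_mode (- l) (2 * pi * real q / real n)" for q
      unfolding z_def by (simp add: fourier_mode_power)
    have abs\<theta>: "\<bar>\<theta>\<bar> = 2 * pi * \<bar>of_int l\<bar> / real n" by (simp add: \<theta>_def abs_mult)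
    show ?thesis
    proof (cases "2 * \<bar>l\<bar> \<le> int n")
      case small: True
      have "2 * \<bar>of_int l\<bar> \<le> real n" using small by linarith
      then have \<theta>: "\<bar>\<theta>\<bar> \<le> pi" "\<theta> \<noteq> 0" unfolding abs\<theta> using n False by (auto simp: field_simps \<theta>_def)
      have z1: "1 - z \<noteq> 0" using norm_cis_minus_one_ge[OF \<theta>(1)] \<theta>(2) unfolding zc by auto
      have sum: "(\<Sum>q=q0..<q1. z ^ q) = (z ^ q0 - z ^ q1) / (1 - z)"
        using geometric_sum_times[OF q(1), of z] z1 by (simp add: field_simps)
      have close: "cmod (fourier_mode (- l) (2 * pi * real q / real n) - fourier_mode (- l) c) \<le> \<bar>\<theta>\<bar>"
        if "\<bar>2 * pi * real q / real n - c\<bar> \<le> 2 * pi / real n" for q c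
      proof -
        have "cmod (fourier_mode (- l) (2 * pi * real q / real n) - fourier_mode (- l) c) \<le> \<bar>of_int (- l)\<bar> * \<bar>2 * pi * real q / real n - c\<bar>"
          by (rule norm_fourier_mode_diff)
        also have "\<dots> \<le> \<bar>of_int (- l)\<bar> * (2 * pi / real n)" using that by (intro mult_left_mono) auto
        also have "\<dots> = \<bar>\<theta>\<bar>" unfolding abs\<theta> by simp
        finally show ?thesis .
      qed
      have "dft_coeff n (indicator {a..b}) l - fourier_coeff (indicator {a..b}) l
        = ((z ^ q0 - z ^ q1) * (1 / (1 - z) + 1 / (\<i> * of_real \<theta>))
           - ((z ^ q0 - fourier_mode (- l) a) - (z ^ q1 - fourier_mode (- l) b)) / (\<i> * of_real \<theta>)) / of_nat n"
      proof -
        have alg: "A / w / N - (- B / (N * T)) = (A * (1 / w + 1 / T) - (A - B) / T) / N"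
          if "w \<noteq> 0" "T \<noteq> 0" "N \<noteq> 0" for A B w T N :: complex
          using that by (simp add: divide_simps) (simp add: algebra_simps)
        have "(z ^ q0 - fourier_mode (- l) a) - (z ^ q1 - fourier_mode (- l) b) = (z ^ q0 - z ^ q1) - (fourier_mode (- l) a - fourier_mode (- l) b)"
          by simp
        then show ?thesis unfolding dft sum fc using z1 \<theta> n by (simp only:, intro alg) auto
      qed
      also have "cmod \<dots> = cmod ((z ^ q0 - z ^ q1) * (1 / (1 - z) + 1 / (\<i> * of_real \<theta>))
           - ((z ^ q0 - fourier_mode (- l) a) - (z ^ q1 - fourier_mode (- l) b)) / (\<i> * of_real \<theta>)) / real n"
        by (simp only: norm_divide norm_of_nat)
      also have "\<dots> \<le> 6 / real n"
      proof (rule divide_right_mono)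
        have "cmod ((z ^ q0 - z ^ q1) * (1 / (1 - z) + 1 / (\<i> * of_real \<theta>))) \<le> 2 * 2"
          unfolding norm_mult
          using norm_triangle_ineq4[of "z ^ q0" "z ^ q1"] inverse_remainder[OF \<theta>(2,1)]
          by (intro mult_mono) (auto simp: zq zc[symmetric])
        moreover have "cmod (((z ^ q0 - fourier_mode (- l) a) - (z ^ q1 - fourier_mode (- l) b)) / (\<i> * of_real \<theta>)) \<le> 2"
        proof -
          have "cmod ((z ^ q0 - fourier_mode (- l) a) - (z ^ q1 - fourier_mode (- l) b)) \<le> \<bar>\<theta>\<bar> + \<bar>\<theta>\<bar>"
            unfolding zq by (rule order.trans[OF norm_triangle_ineq4]) (intro add_mono close q)
          then show ?thesis using \<theta>(2) by (simp add: norm_divide norm_mult field_simps)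
        qed
        ultimately show "cmod ((z ^ q0 - z ^ q1) * (1 / (1 - z) + 1 / (\<i> * of_real \<theta>))
           - ((z ^ q0 - fourier_mode (- l) a) - (z ^ q1 - fourier_mode (- l) b)) / (\<i> * of_real \<theta>)) \<le> 6"
          by (intro order.trans[OF norm_triangle_ineq4]) linarith
      qed simp
      finally show ?thesis using small by simp
    next
      case large: False
      have ln: "real n < 2 * \<bar>of_int l\<bar>" "\<bar>of_int l\<bar> < real n" using large l by linarith+
      \<comment> \<open>The angle of \<open>z\<close> is reduced to the interval from \<open>-pi\<close> to \<open>pi\<close>.\<close>
      define \<eta> where "\<eta> = (if l > 0 then \<theta> + 2 * pi else \<theta> - 2 * pi)"
      have z\<eta>: "z = cis \<eta>" unfolding zc \<eta>_def by (simp add: cis.ctr cos_diff sin_diff)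
      have abs\<eta>: "\<bar>\<eta>\<bar> = 2 * pi * (real n - \<bar>of_int l\<bar>) / real n"
      proof -
        have "\<eta> = (if l > 0 then 1 else -1) * (2 * pi * (real n - \<bar>of_int l\<bar>) / real n)"
          using n False by (auto simp: \<eta>_def \<theta>_def field_simps)
        then show ?thesis using ln n by (auto simp: abs_mult)
      qed
      have "\<bar>\<eta>\<bar> \<le> pi" unfolding abs\<eta> using ln n by (simp add: field_simps)
      from norm_cis_minus_one_ge[OF this] have ge: "pi * (real n - \<bar>of_int l\<bar>) / real n \<le> cmod (1 - z)"
        unfolding abs\<eta> z\<eta> by simp
      have pos: "0 < pi * (real n - \<bar>of_int l\<bar>) / real n" using ln n by simp
      have z1: "1 - z \<noteq> 0" using ge pos by auto
      have sum: "(\<Sum>q=q0..<q1. z ^ q) = (z ^ q0 - z ^ q1) / (1 - z)"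
        using geometric_sum_times[OF q(1), of z] z1 by (simp add: field_simps)
      have "cmod (dft_coeff n (indicator {a..b}) l) = cmod (z ^ q0 - z ^ q1) / cmod (1 - z) / real n"
        unfolding dft sum by (simp add: norm_divide norm_mult)
      also have "\<dots> \<le> 2 / (pi * (real n - \<bar>of_int l\<bar>) / real n) / real n"
        using norm_triangle_ineq4[of "z ^ q0" "z ^ q1"] ge pos
        by (intro divide_right_mono frac_le) (auto simp: zq)
      also have "\<dots> = 2 / pi * (1 / (real n - \<bar>of_int l\<bar>))" using n by simp
      also have "\<dots> \<le> 1 * (1 / (real n - \<bar>of_int l\<bar>))"
        using ln pi_gt3 by (intro mult_right_mono) auto
      finally have 1: "cmod (dft_coeff n (indicator {a..b}) l) \<le> 1 / (real n - \<bar>of_int l\<bar>)" by simp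
      have "cmod (fourier_coeff (indicator {a..b}) l) = cmod (fourier_mode (- l) a - fourier_mode (- l) b) / (2 * pi * \<bar>of_int l\<bar>)"
        unfolding fourier_coeff_indicator[OF ab] using False by (simp add: norm_divide norm_mult)
      also have "\<dots> \<le> 2 / (2 * \<bar>of_int l\<bar>)"
        using norm_triangle_ineq4[of "fourier_mode (- l) a" "fourier_mode (- l) b"] False pi_gt3
        by (intro frac_le) auto
      also have "\<dots> \<le> 1 / (real n - \<bar>of_int l\<bar>)"
        using ln by (simp add: field_simps)
      finally have 2: "cmod (fourier_coeff (indicator {a..b}) l) \<le> 1 / (real n - \<bar>of_int l\<bar>)" .
      have "cmod (dft_coeff n (indicator {a..b}) l - fourier_coeff (indicator {a..b}) l) \<le> 1 / (real n - \<bar>of_int l\<bar>) + 1 / (real n - \<bar>of_int l\<bar>)"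
        by (rule order.trans[OF norm_triangle_ineq4 add_mono[OF 1 2]])
      also have "\<dots> \<le> 6 / (real n - \<bar>of_int l\<bar>)" using ln by (simp add: field_simps)
      finally show ?thesis using large by simp
    qed
  qed
qed

text \<open>Telescoping, by \<open>1 / m\<^sup>2 \<le> 2 / m - 2 / (m + 1)\<close>.\<close>

lemma sum_inverse_squares_le:
  "(\<Sum>k<n. 1 / (real j + 1 + real k)\<^sup>2) \<le> 2 / (real j + 1) - 2 / (real j + 1 + real n)"
proof (induction n)
  case (Suc n)
  define m where "m = real j + 1 + real n"
  have m: "m \<ge> 1" unfolding m_def by simp
  have "1 / m\<^sup>2 \<le> 2 / m - 2 / (m + 1)"
  proof -
    have "2 / m - 2 / (m + 1) - 1 / m\<^sup>2 = (m - 1) / (m\<^sup>2 * (m + 1))"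
      using m by (simp add: divide_simps power2_eq_square)
    moreover have "\<dots> \<ge> 0" using m by simp
    ultimately show ?thesis by linarith
  qed
  then show ?case using Suc unfolding m_def by (simp add: algebra_simps)
qed simp

lemma harmonic_sum_le: "n > 0 \<Longrightarrow> (\<Sum>j<n. 1 / (real j + 1)) \<le> 1 + ln (real n)"
proof (induction n)
  case (Suc n)
  show ?case
  proof (cases "n = 0")
    case False
    have "ln (real n / (real n + 1)) \<le> real n / (real n + 1) - 1"
      using False by (intro ln_le_minus_one) auto
    also have "\<dots> = - (1 / (real n + 1))" by (simp add: field_simps)
    also have "ln (real n / (real n + 1)) = ln (real n) - ln (real n + 1)"
      using False by (simp add: ln_div)
    finally show ?thesis using Suc.IH False by (simp add: add.commute)
  qed simp
qed simp

text \<open>The diagonal \<open>l\<close> has \<open>n - \<bar>l\<bar>\<close> entries. Errors of order \<open>1 / n\<close> contribute a bounded amount in total, and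
  near the two corners \<open>\<Sum>(n - \<bar>l\<bar>) / (n - \<bar>l\<bar>)\<^sup>2\<close> is a harmonic sum; this is the origin of the logarithm.\<close>

lemma frobenius_sq_toeplitz_error:
  assumes n: "n > 0" and C: "C \<ge> 0"
    and D: "\<And>l. \<bar>l\<bar> < int n \<Longrightarrow> cmod (D l) \<le> (if 2 * \<bar>l\<bar> \<le> int n then C / real n else C / (real n - \<bar>of_int l\<bar>))"
  shows "frobenius_sq (Matrix.mat n n (\<lambda>(j, k). D (int j - int k))) \<le> C\<^sup>2 * (5 + 4 * ln (real n))"
proof -
  have entry: "(cmod (D (int j - int k)))\<^sup>2
      \<le> C\<^sup>2 * (1 / (real n)\<^sup>2 + 1 / (real n - real j + real k)\<^sup>2 + 1 / (real n - real k + real j)\<^sup>2)"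
    if jk: "j < n" "k < n" for j k
  proof -
    define l where "l = int j - int k"
    have l: "\<bar>l\<bar> < int n" using jk unfolding l_def by auto
    have nl: "real n - \<bar>of_int l\<bar> > 0" using l by linarith
    have "(cmod (D l))\<^sup>2 \<le> C\<^sup>2 * (1 / (real n)\<^sup>2 + 1 / (real n - \<bar>of_int l\<bar>)\<^sup>2)"
    proof (cases "2 * \<bar>l\<bar> \<le> int n")
      case True
      then have "(cmod (D l))\<^sup>2 \<le> (C / real n)\<^sup>2" using D[OF l] by (intro power_mono) auto
      then have "(cmod (D l))\<^sup>2 \<le> C\<^sup>2 * (1 / (real n)\<^sup>2)" by (simp add: power_divide)
      also have "\<dots> \<le> C\<^sup>2 * (1 / (real n)\<^sup>2 + 1 / (real n - \<bar>of_int l\<bar>)\<^sup>2)" by (intro mult_left_mono) auto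
      finally show ?thesis .
    next
      case False
      then have "(cmod (D l))\<^sup>2 \<le> (C / (real n - \<bar>of_int l\<bar>))\<^sup>2" using D[OF l] by (intro power_mono) auto
      then have "(cmod (D l))\<^sup>2 \<le> C\<^sup>2 * (1 / (real n - \<bar>of_int l\<bar>)\<^sup>2)" by (simp add: power_divide)
      also have "\<dots> \<le> C\<^sup>2 * (1 / (real n)\<^sup>2 + 1 / (real n - \<bar>of_int l\<bar>)\<^sup>2)" by (intro mult_left_mono) auto
      finally show ?thesis .
    qed
    also have "\<dots> \<le> C\<^sup>2 * (1 / (real n)\<^sup>2 + 1 / (real n - real j + real k)\<^sup>2 + 1 / (real n - real k + real j)\<^sup>2)"
    proof (intro mult_left_mono)
      have "real n - \<bar>of_int l\<bar> = real n - real j + real k \<or> real n - \<bar>of_int l\<bar> = real n - real k + real j"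
        unfolding l_def by linarith
      then show "1 / (real n)\<^sup>2 + 1 / (real n - \<bar>of_int l\<bar>)\<^sup>2
        \<le> 1 / (real n)\<^sup>2 + 1 / (real n - real j + real k)\<^sup>2 + 1 / (real n - real k + real j)\<^sup>2"
        by (elim disjE; simp only:; simp)
    qed auto
    finally show ?thesis unfolding l_def .
  qed
  have tri: "(\<Sum>j<n. \<Sum>k<n. 1 / (real n - real j + real k)\<^sup>2) \<le> 2 * (1 + ln (real n))"
  proof -
    \<comment> \<open>Reversing the rows moves the corner to the origin.\<close>
    have "(\<Sum>j<n. \<Sum>k<n. 1 / (real n - real j + real k)\<^sup>2)
        = (\<Sum>j<n. \<Sum>k<n. 1 / (real n - real (n - Suc j) + real k)\<^sup>2)"
      by (subst sum.nat_diff_reindex[symmetric]) simp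
    also have "\<dots> = (\<Sum>j<n. \<Sum>k<n. 1 / (real j + 1 + real k)\<^sup>2)"
      by (intro sum.cong refl) (simp add: of_nat_diff algebra_simps)
    also have "\<dots> \<le> (\<Sum>j<n. 2 * (1 / (real j + 1)))"
    proof (intro sum_mono)
      fix j
      have "(\<Sum>k<n. 1 / (real j + 1 + real k)\<^sup>2) \<le> 2 / (real j + 1) - 2 / (real j + 1 + real n)"
        by (rule sum_inverse_squares_le)
      also have "\<dots> \<le> 2 * (1 / (real j + 1))" by simp
      finally show "(\<Sum>k<n. 1 / (real j + 1 + real k)\<^sup>2) \<le> 2 * (1 / (real j + 1))" .
    qed
    also have "\<dots> \<le> 2 * (1 + ln (real n))"
      unfolding sum_distrib_left[symmetric] using harmonic_sum_le[OF n] by simp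
    finally show ?thesis .
  qed
  have tri': "(\<Sum>j<n. \<Sum>k<n. 1 / (real n - real k + real j)\<^sup>2) \<le> 2 * (1 + ln (real n))"
    by (subst sum.swap) (rule tri)
  have "frobenius_sq (Matrix.mat n n (\<lambda>(j, k). D (int j - int k))) = (\<Sum>j<n. \<Sum>k<n. (cmod (D (int j - int k)))\<^sup>2)"
    unfolding frobenius_sq_entries by simp
  also have "\<dots> \<le> (\<Sum>j<n. \<Sum>k<n. C\<^sup>2 * (1 / (real n)\<^sup>2 + 1 / (real n - real j + real k)\<^sup>2 + 1 / (real n - real k + real j)\<^sup>2))"
    by (intro sum_mono entry) auto
  also have "\<dots> = C\<^sup>2 * (1 + (\<Sum>j<n. \<Sum>k<n. 1 / (real n - real j + real k)\<^sup>2) + (\<Sum>j<n. \<Sum>k<n. 1 / (real n - real k + real j)\<^sup>2))"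
    using n by (simp add: sum_distrib_left[symmetric] sum.distrib power2_eq_square)
  also have "\<dots> \<le> C\<^sup>2 * (5 + 4 * ln (real n))"
    using tri tri' by (intro mult_left_mono) auto
  finally show ?thesis .
qed

section \<open>Regulated functions and step functions\<close>

text \<open>On a compact interval these are the uniform limits of step functions.\<close>

definition regulated :: "(real \<Rightarrow> complex) \<Rightarrow> bool" where
  "regulated \<phi> \<longleftrightarrow> (\<forall>x. (\<exists>l. (\<phi> \<longlongrightarrow> l) (at_left x)) \<and> (\<exists>r. (\<phi> \<longlongrightarrow> r) (at_right x)))"

lemma regulated_add: "regulated \<phi> \<Longrightarrow> regulated \<psi> \<Longrightarrow> regulated (\<lambda>x. \<phi> x + \<psi> x)"
  unfolding regulated_def
proof (intro allI)
  fix x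
  assume "\<forall>x. (\<exists>l. (\<phi> \<longlongrightarrow> l) (at_left x)) \<and> (\<exists>r. (\<phi> \<longlongrightarrow> r) (at_right x))"
    and "\<forall>x. (\<exists>l. (\<psi> \<longlongrightarrow> l) (at_left x)) \<and> (\<exists>r. (\<psi> \<longlongrightarrow> r) (at_right x))"
  then obtain l r l' r' where "(\<phi> \<longlongrightarrow> l) (at_left x)" "(\<phi> \<longlongrightarrow> r) (at_right x)"
    "(\<psi> \<longlongrightarrow> l') (at_left x)" "(\<psi> \<longlongrightarrow> r') (at_right x)" by blast
  then have "((\<lambda>x. \<phi> x + \<psi> x) \<longlongrightarrow> l + l') (at_left x)" "((\<lambda>x. \<phi> x + \<psi> x) \<longlongrightarrow> r + r') (at_right x)"
    by (auto intro: tendsto_add)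
  then show "(\<exists>l. ((\<lambda>x. \<phi> x + \<psi> x) \<longlongrightarrow> l) (at_left x)) \<and> (\<exists>r. ((\<lambda>x. \<phi> x + \<psi> x) \<longlongrightarrow> r) (at_right x))"
    by blast
qed

lemma regulated_mult: "regulated \<phi> \<Longrightarrow> regulated \<psi> \<Longrightarrow> regulated (\<lambda>x. \<phi> x * \<psi> x)"
  unfolding regulated_def
proof (intro allI)
  fix x
  assume "\<forall>x. (\<exists>l. (\<phi> \<longlongrightarrow> l) (at_left x)) \<and> (\<exists>r. (\<phi> \<longlongrightarrow> r) (at_right x))"
    and "\<forall>x. (\<exists>l. (\<psi> \<longlongrightarrow> l) (at_left x)) \<and> (\<exists>r. (\<psi> \<longlongrightarrow> r) (at_right x))"
  then obtain l r l' r' where "(\<phi> \<longlongrightarrow> l) (at_left x)" "(\<phi> \<longlongrightarrow> r) (at_right x)"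
    "(\<psi> \<longlongrightarrow> l') (at_left x)" "(\<psi> \<longlongrightarrow> r') (at_right x)" by blast
  then have "((\<lambda>x. \<phi> x * \<psi> x) \<longlongrightarrow> l * l') (at_left x)" "((\<lambda>x. \<phi> x * \<psi> x) \<longlongrightarrow> r * r') (at_right x)"
    by (auto intro: tendsto_mult)
  then show "(\<exists>l. ((\<lambda>x. \<phi> x * \<psi> x) \<longlongrightarrow> l) (at_left x)) \<and> (\<exists>r. ((\<lambda>x. \<phi> x * \<psi> x) \<longlongrightarrow> r) (at_right x))"
    by blast
qed

lemma regulated_continuous:
  assumes "continuous_on UNIV \<phi>" shows "regulated \<phi>"
proof -
  have "(\<phi> \<longlongrightarrow> \<phi> x) (at x)" for x
    using assms by (simp add: continuous_on_eq_continuous_at isCont_def)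
  then show ?thesis unfolding regulated_def filterlim_at_split by blast
qed

lemma regulated_fourier_mode: "regulated (fourier_mode m)"
  by (intro regulated_continuous continuous_fourier_mode)

lemma regulated_const: "regulated (\<lambda>_. c)"
  by (intro regulated_continuous continuous_intros)

lemma regulated_indicator: "regulated (indicator {a..b})"
  unfolding regulated_def
proof (intro allI conjI)
  fix x
  have "\<exists>l. \<forall>\<^sub>F y in at_left x. indicator {a..b} y = (l :: complex)"
    unfolding eventually_at_left_field
  proof -
    consider "x \<le> a" | "a < x" "x \<le> b" | "a < x" "b < x" by linarith
    then show "\<exists>l. \<exists>c<x. \<forall>y>c. y < x \<longrightarrow> indicator {a..b} y = (l :: complex)"
    proof cases
      case 1
      then show ?thesis by (intro exI[of _ 0] exI[of _ "x - 1"]) (auto simp: indicator_def)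
    next
      case 2
      then show ?thesis by (intro exI[of _ 1] exI[of _ a]) (auto simp: indicator_def)
    next
      case 3
      then show ?thesis by (intro exI[of _ 0] exI[of _ b]) (auto simp: indicator_def)
    qed
  qed
  then show "\<exists>l :: complex. (indicator {a..b} \<longlongrightarrow> l) (at_left x)"
    by (blast intro: tendsto_eventually)
  have "\<exists>l. \<forall>\<^sub>F y in at_right x. indicator {a..b} y = (l :: complex)"
    unfolding eventually_at_right_field
  proof -
    consider "x < a" "x < b" | "a \<le> x" "x < b" | "b \<le> x" by linarith
    then show "\<exists>l. \<exists>c>x. \<forall>y>x. y < c \<longrightarrow> indicator {a..b} y = (l :: complex)"
    proof cases
      case 1
      then show ?thesis by (intro exI[of _ 0] exI[of _ a]) (auto simp: indicator_def)
    next
      case 2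
      then show ?thesis by (intro exI[of _ 1] exI[of _ b]) (auto simp: indicator_def)
    next
      case 3
      then show ?thesis by (intro exI[of _ 0] exI[of _ "x + 1"]) (auto simp: indicator_def)
    qed
  qed
  then show "\<exists>l :: complex. (indicator {a..b} \<longlongrightarrow> l) (at_right x)"
    by (blast intro: tendsto_eventually)
qed

text \<open>Closed intervals may degenerate to a point, so the value of a step function at a single point can be
  prescribed. Thus the approximation below holds at every point, including the jumps, which the grid may hit.\<close>

inductive step_fun :: "(real \<Rightarrow> complex) \<Rightarrow> bool" where
  step_zero: "step_fun (\<lambda>_. 0)"
| step_add: "step_fun \<sigma> \<Longrightarrow> 0 \<le> a \<Longrightarrow> a \<le> b \<Longrightarrow> b \<le> 2 * pi \<Longrightarrow> step_fun (\<lambda>x. \<sigma> x + c * indicator {a..b} x)"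

lemma step_fun_add:
  assumes "step_fun \<tau>" "step_fun \<sigma>" shows "step_fun (\<lambda>x. \<sigma> x + \<tau> x)"
  using assms
proof (induction rule: step_fun.induct)
  case (step_add \<tau> a b c)
  then have "step_fun (\<lambda>x. (\<sigma> x + \<tau> x) + c * indicator {a..b} x)"
    by (intro step_fun.step_add) auto
  then show ?case by (simp add: add.assoc)
qed simp

lemma step_fun_indicator:
  "0 \<le> a \<Longrightarrow> a \<le> b \<Longrightarrow> b \<le> 2 * pi \<Longrightarrow> step_fun (\<lambda>x. c * indicator {a..b} x)"
  using step_add[OF step_zero, of a b c] by simp

lemma regulated_step_fun: "step_fun \<sigma> \<Longrightarrow> regulated \<sigma>"
  by (induction rule: step_fun.induct)
    (auto intro!: regulated_const regulated_add regulated_mult regulated_indicator)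

text \<open>Near each point the one-sided limits and the value determine a step function with three parts; a
  bisection argument glues these together.\<close>

lemma regulated_step_approx:
  assumes reg: "regulated \<phi>" and \<epsilon>: "\<epsilon> > 0"
  obtains \<sigma> where "step_fun \<sigma>" "\<And>x. x \<in> {0..2 * pi} \<Longrightarrow> cmod (\<phi> x - \<sigma> x) \<le> \<epsilon>"
proof -
  define P where "P a b \<longleftrightarrow> (0 \<le> a \<and> b \<le> 2 * pi \<longrightarrow>
    (\<exists>\<sigma>. step_fun \<sigma> \<and> (\<forall>x\<in>{a..b}. cmod (\<phi> x - \<sigma> x) \<le> \<epsilon>) \<and> (\<forall>x. x \<notin> {a..b} \<longrightarrow> \<sigma> x = 0)))" for a b
  have "P 0 (2 * pi)"
  proof (rule Bolzano)
    show "0 \<le> 2 * pi" by simp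
  next
    fix a b c assume ab: "P a b" and bc: "P b c" and le: "a \<le> b" "b \<le> c"
    show "P a c"
      unfolding P_def
    proof
      assume ac: "0 \<le> a \<and> c \<le> 2 * pi"
      obtain \<sigma> where \<sigma>: "step_fun \<sigma>" "\<forall>x\<in>{a..b}. cmod (\<phi> x - \<sigma> x) \<le> \<epsilon>" "\<forall>x. x \<notin> {a..b} \<longrightarrow> \<sigma> x = 0"
        using ab ac le unfolding P_def by auto
      obtain \<tau> where \<tau>: "step_fun \<tau>" "\<forall>x\<in>{b..c}. cmod (\<phi> x - \<tau> x) \<le> \<epsilon>" "\<forall>x. x \<notin> {b..c} \<longrightarrow> \<tau> x = 0"
        using bc ac le unfolding P_def by auto
      \<comment> \<open>Both pieces contribute at the common endpoint, so one of the values is subtracted.\<close>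
      define \<rho> where "\<rho> x = (\<sigma> x + \<tau> x) + (- \<tau> b) * indicator {b..b} x" for x
      have "step_fun \<rho>"
        unfolding \<rho>_def using ac le by (intro step_add step_fun_add \<sigma> \<tau>) auto
      moreover have "cmod (\<phi> x - \<rho> x) \<le> \<epsilon>" if "x \<in> {a..c}" for x
      proof -
        consider "x < b" | "x = b" | "x > b" by linarith
        then show ?thesis using \<sigma>(2,3) \<tau>(2,3) that le by cases (auto simp: \<rho>_def)
      qed
      moreover have "\<rho> x = 0" if "x \<notin> {a..c}" for x
        using \<sigma>(3) \<tau>(3) that le by (auto simp: \<rho>_def indicator_def)
      ultimately show "\<exists>\<sigma>. step_fun \<sigma> \<and> (\<forall>x\<in>{a..c}. cmod (\<phi> x - \<sigma> x) \<le> \<epsilon>) \<and> (\<forall>x. x \<notin> {a..c} \<longrightarrow> \<sigma> x = 0)"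
        by blast
    qed
  next
    fix x :: real assume "0 \<le> x" "x \<le> 2 * pi"
    obtain l r where l: "(\<phi> \<longlongrightarrow> l) (at_left x)" and r: "(\<phi> \<longlongrightarrow> r) (at_right x)"
      using reg unfolding regulated_def by blast
    obtain u where u: "u < x" "\<And>y. u < y \<Longrightarrow> y < x \<Longrightarrow> dist (\<phi> y) l < \<epsilon>"
      using tendstoD[OF l \<epsilon>] unfolding eventually_at_left_field by blast
    obtain w where w: "x < w" "\<And>y. x < y \<Longrightarrow> y < w \<Longrightarrow> dist (\<phi> y) r < \<epsilon>"
      using tendstoD[OF r \<epsilon>] unfolding eventually_at_right_field by blast
    have "P a b" if ab: "a \<le> x" "x \<le> b" "b - a < min (x - u) (w - x)" for a b
      unfolding P_def
    proof
      assume range: "0 \<le> a \<and> b \<le> 2 * pi"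
      define \<sigma> where "\<sigma> y = l * indicator {a..x} y + r * indicator {x..b} y + (\<phi> x - l - r) * indicator {x..x} y" for y
      have "step_fun \<sigma>"
        unfolding \<sigma>_def using ab range by (intro step_add step_fun_indicator) auto
      moreover have "cmod (\<phi> y - \<sigma> y) \<le> \<epsilon>" if y: "y \<in> {a..b}" for y
      proof -
        consider "y < x" | "y = x" | "y > x" by linarith
        then show ?thesis
        proof cases
          case 1
          then have "u < y" using ab y by auto
          with 1 show ?thesis using u(2)[of y] y ab by (simp add: \<sigma>_def dist_norm)
        next
          case 2
          then show ?thesis using ab \<epsilon> by (simp add: \<sigma>_def)
        next
          case 3
          then have "y < w" using ab y by auto
          with 3 show ?thesis using w(2)[of y] y ab by (simp add: \<sigma>_def dist_norm)
        qed
      qed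
      moreover have "\<sigma> y = 0" if "y \<notin> {a..b}" for y
        using that ab by (auto simp: \<sigma>_def indicator_def)
      ultimately show "\<exists>\<sigma>. step_fun \<sigma> \<and> (\<forall>x\<in>{a..b}. cmod (\<phi> x - \<sigma> x) \<le> \<epsilon>) \<and> (\<forall>x. x \<notin> {a..b} \<longrightarrow> \<sigma> x = 0)"
        by blast
    qed
    then show "\<exists>d>0. \<forall>a b. a \<le> x \<and> x \<le> b \<and> b - a < d \<longrightarrow> P a b"
      using u(1) w(1) by (intro exI[of _ "min (x - u) (w - x)"]) auto
  qed
  then show ?thesis using that unfolding P_def by auto
qed

lemma regulated_integrable:
  assumes "regulated \<phi>" shows "\<phi> integrable_on {0..2 * pi}"
proof -
  have step: "\<sigma> integrable_on {0..2 * pi}" if "step_fun \<sigma>" for \<sigma>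
    using that
  proof (induction rule: step_fun.induct)
    case (step_add \<sigma> a b c)
    have "((\<lambda>x. if x \<in> {a..b} then c else 0) has_integral (b - a) *\<^sub>R c) {0..2 * pi}"
      using step_add has_integral_const_real[of c a b] by (subst has_integral_restrict) auto
    moreover have "(\<lambda>x. if x \<in> {a..b} then c else 0) = (\<lambda>x. c * indicator {a..b} x)"
      by (auto simp: indicator_def)
    ultimately have "(\<lambda>x. c * indicator {a..b} x) integrable_on {0..2 * pi}" by auto
    then show ?case using step_add.IH by (rule integrable_add[rotated])
  qed (simp add: integrable_0)
  have "\<phi> integrable_on cbox 0 (2 * pi)"
  proof (rule integrable_uniform_limit)
    fix e :: real assume "e > 0"
    from regulated_step_approx[OF assms this] obtain \<sigma> where
      "step_fun \<sigma>" "\<And>x. x \<in> {0..2 * pi} \<Longrightarrow> cmod (\<phi> x - \<sigma> x) \<le> e" by blast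
    then show "\<exists>g. (\<forall>x\<in>cbox 0 (2 * pi). norm (\<phi> x - g x) \<le> e) \<and> g integrable_on cbox 0 (2 * pi)"
      using step[of \<sigma>] by (intro exI[of _ \<sigma>]) (simp add: cbox_interval)
  qed
  then show ?thesis by (simp add: cbox_interval)
qed

lemma has_integral_fourier_coeff:
  assumes "regulated \<phi>"
  shows "((\<lambda>x. \<phi> x * fourier_mode (- l) x) has_integral 2 * pi * fourier_coeff \<phi> l) {0..2 * pi}"
proof -
  have "(\<lambda>x. \<phi> x * fourier_mode (- l) x) integrable_on {0..2 * pi}"
    by (intro regulated_integrable regulated_mult regulated_fourier_mode assms)
  from integrable_integral[OF this] show ?thesis by (simp add: fourier_coeff_def)
qed

lemma fourier_coeffI:
  fixes c :: complex
  assumes "((\<lambda>x. \<phi> x * fourier_mode (- l) x) has_integral 2 * pi * c) {0..2 * pi}"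
  shows "fourier_coeff \<phi> l = c"
  using integral_unique[OF assms] by (simp add: fourier_coeff_def)

lemma fourier_coeff_add:
  assumes "regulated \<phi>" "regulated \<psi>"
  shows "fourier_coeff (\<lambda>x. \<phi> x + \<psi> x) l = fourier_coeff \<phi> l + fourier_coeff \<psi> l"
  by (rule fourier_coeffI)
    (use has_integral_add[OF assms[THEN has_integral_fourier_coeff]] in \<open>simp add: ring_distribs\<close>)

lemma fourier_coeff_cmult:
  assumes "regulated \<phi>"
  shows "fourier_coeff (\<lambda>x. c * \<phi> x) l = c * fourier_coeff \<phi> l"
  by (rule fourier_coeffI)
    (use has_integral_mult_right[OF has_integral_fourier_coeff[OF assms], of c] in \<open>simp add: mult_ac\<close>)

lemma dft_coeff_add: "dft_coeff n (\<lambda>x. \<phi> x + \<psi> x) l = dft_coeff n \<phi> l + dft_coeff n \<psi> l"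
  by (simp add: dft_coeff_def ring_distribs sum.distrib)

lemma dft_coeff_cmult: "dft_coeff n (\<lambda>x. c * \<phi> x) l = c * dft_coeff n \<phi> l"
  by (simp add: dft_coeff_def sum_distrib_left mult_ac)

section \<open>Sampling error of step functions\<close>

text \<open>The difference of the Toeplitz and the circulant matrix with the same symbol.\<close>

definition sampling_error :: "nat \<Rightarrow> (real \<Rightarrow> complex) \<Rightarrow> complex mat" where
  "sampling_error n \<phi> = Matrix.mat n n (\<lambda>(j, k).
     fourier_coeff \<phi> (int j - int k) - dft_coeff n \<phi> (int j - int k))"

lemma sampling_error_carrier [simp]: "sampling_error n h \<in> carrier_mat n n"
  by (simp add: sampling_error_def)

lemma frobenius_sq_add_le:
  assumes "A \<in> carrier_mat n m" "B \<in> carrier_mat n m"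
  shows "frobenius_sq (A + B) \<le> 2 * frobenius_sq A + 2 * frobenius_sq B"
proof -
  have "(cmod (a + b))\<^sup>2 \<le> 2 * (cmod a)\<^sup>2 + 2 * (cmod b)\<^sup>2" for a b
  proof -
    have "(cmod (a + b))\<^sup>2 \<le> (cmod a + cmod b)\<^sup>2" by (intro power_mono norm_triangle_ineq) auto
    also have "\<dots> \<le> 2 * (cmod a)\<^sup>2 + 2 * (cmod b)\<^sup>2"
      using sum_squares_bound[of "cmod a" "cmod b"] by (simp add: power2_sum)
    finally show ?thesis .
  qed
  then have "(\<Sum>i<n. \<Sum>j<m. (cmod (A $$ (i,j) + B $$ (i,j)))\<^sup>2)
     \<le> (\<Sum>i<n. \<Sum>j<m. 2 * (cmod (A $$ (i,j)))\<^sup>2 + 2 * (cmod (B $$ (i,j)))\<^sup>2)"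
    by (intro sum_mono)
  also have "\<dots> = 2 * (\<Sum>i<n. \<Sum>j<m. (cmod (A $$ (i,j)))\<^sup>2) + 2 * (\<Sum>i<n. \<Sum>j<m. (cmod (B $$ (i,j)))\<^sup>2)"
    by (simp add: sum.distrib sum_distrib_left)
  finally show ?thesis using assms by (simp add: frobenius_sq_entries)
qed

lemma frobenius_sq_smult: "frobenius_sq (c \<cdot>\<^sub>m A) = (cmod c)\<^sup>2 * frobenius_sq A"
  by (simp add: frobenius_sq_entries norm_mult power_mult_distrib sum_distrib_left)

lemma frobenius_sq_sampling_error_step:
  assumes "step_fun \<sigma>"
  shows "\<exists>K\<ge>0. \<forall>n>0. frobenius_sq (sampling_error n \<sigma>) \<le> K * (5 + 4 * ln (real n))"
  using assms
proof (induction rule: step_fun.induct)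
  case step_zero
  have "frobenius_sq (sampling_error n (\<lambda>_. 0)) = 0" for n
    by (simp add: frobenius_sq_entries sampling_error_def fourier_coeff_def dft_coeff_def)
  then show ?case by (intro exI[of _ 0]) simp
next
  case (step_add \<sigma> a b c)
  obtain K where K: "K \<ge> 0" "\<And>n. n > 0 \<Longrightarrow> frobenius_sq (sampling_error n \<sigma>) \<le> K * (5 + 4 * ln (real n))"
    using step_add.IH by blast
  let ?\<chi> = "indicator {a..b} :: real \<Rightarrow> complex"
  have "frobenius_sq (sampling_error n (\<lambda>x. \<sigma> x + c * ?\<chi> x)) \<le> (2 * K + 2 * ((cmod c)\<^sup>2 * 6\<^sup>2)) * (5 + 4 * ln (real n))"
    if n: "n > 0" for n
  proof -
    have "sampling_error n (\<lambda>x. \<sigma> x + c * ?\<chi> x) = sampling_error n \<sigma> + c \<cdot>\<^sub>m sampling_error n ?\<chi>"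
      by (rule eq_matI) (auto simp: sampling_error_def dft_coeff_add dft_coeff_cmult
          fourier_coeff_add[OF regulated_step_fun[OF step_add.hyps(1)] regulated_mult[OF regulated_const regulated_indicator]]
          fourier_coeff_cmult[OF regulated_indicator] right_diff_distrib)
    then have "frobenius_sq (sampling_error n (\<lambda>x. \<sigma> x + c * ?\<chi> x))
       \<le> 2 * frobenius_sq (sampling_error n \<sigma>) + 2 * ((cmod c)\<^sup>2 * frobenius_sq (sampling_error n ?\<chi>))"
      using frobenius_sq_add_le[of "sampling_error n \<sigma>" n n "c \<cdot>\<^sub>m sampling_error n ?\<chi>"]
      by (simp add: sampling_error_def frobenius_sq_smult)
    moreover have "frobenius_sq (sampling_error n ?\<chi>) \<le> 6\<^sup>2 * (5 + 4 * ln (real n))"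
      unfolding sampling_error_def
      by (rule frobenius_sq_toeplitz_error[OF n])
        (use coeff_error_indicator[OF step_add.hyps(2-4)] in \<open>auto simp: norm_minus_commute\<close>)
    then have "(cmod c)\<^sup>2 * frobenius_sq (sampling_error n ?\<chi>) \<le> (cmod c)\<^sup>2 * (6\<^sup>2 * (5 + 4 * ln (real n)))"
      by (intro mult_left_mono) auto
    ultimately have "frobenius_sq (sampling_error n (\<lambda>x. \<sigma> x + c * ?\<chi> x))
       \<le> 2 * (K * (5 + 4 * ln (real n))) + 2 * ((cmod c)\<^sup>2 * (6\<^sup>2 * (5 + 4 * ln (real n))))"
      using K(2)[OF n] by linarith
    then show ?thesis by (simp only: distrib_right mult.assoc)
  qed
  then show ?case using K(1) by (intro exI[of _ "2 * K + 2 * ((cmod c)\<^sup>2 * 6\<^sup>2)"]) auto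
qed

section \<open>Norms of Toeplitz matrices\<close>

definition coeff_toeplitz :: "nat \<Rightarrow> (real \<Rightarrow> complex) \<Rightarrow> complex mat" where
  "coeff_toeplitz n \<phi> = Matrix.mat n n (\<lambda>(j, k). fourier_coeff \<phi> (int j - int k))"

lemma coeff_toeplitz_carrier [simp]: "coeff_toeplitz n h \<in> carrier_mat n n"
  by (simp add: coeff_toeplitz_def)

lemma has_integral_fourier_mode_period:
  "(fourier_mode m has_integral (if m = 0 then 2 * pi else 0)) {0..2 * pi}"
proof (cases "m = 0")
  case True
  have "((\<lambda>x. 1 :: complex) has_integral (2 * pi - 0) *\<^sub>R 1) {0..2 * pi}"
    using has_integral_const_real[of "1::complex" 0 "2 * pi"] by simp
  moreover have "fourier_mode 0 = (\<lambda>x. 1)" by (rule ext) simp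
  ultimately show ?thesis using True by (simp add: scaleR_conv_of_real)
next
  case False
  then show ?thesis using has_integral_fourier_mode[of m 0 "2 * pi"] by simp
qed

text \<open>The trigonometric polynomial with coefficient vector \<open>v\<close>: a Toeplitz matrix is
  multiplication by its symbol compressed to these.\<close>

definition trig_sum :: "complex vec \<Rightarrow> real \<Rightarrow> complex" where
  "trig_sum v x = (\<Sum>k<dim_vec v. v $ k * fourier_mode (int k) x)"

lemma trig_sum_product:
  "trig_sum v x * cnj (trig_sum w x)
     = (\<Sum>j<dim_vec w. \<Sum>k<dim_vec v. v $ k * cnj (w $ j) * fourier_mode (- (int j - int k)) x)"
proof -
  have "trig_sum v x * cnj (trig_sum w x)
     = (\<Sum>j<dim_vec w. cnj (w $ j) * fourier_mode (- int j) x) * (\<Sum>k<dim_vec v. v $ k * fourier_mode (int k) x)"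
    by (simp add: trig_sum_def cnj_fourier_mode mult.commute)
  also have "\<dots> = (\<Sum>j<dim_vec w. \<Sum>k<dim_vec v. v $ k * cnj (w $ j) * (fourier_mode (- int j) x * fourier_mode (int k) x))"
    unfolding sum_product by (intro sum.cong refl) (simp add: mult_ac)
  finally show ?thesis by (simp add: fourier_mode_mult)
qed

lemma parseval_trig_sum: "((\<lambda>x. (cmod (trig_sum v x))\<^sup>2) has_integral 2 * pi * vnorm_sq v) {0..2 * pi}"
proof -
  have "((\<lambda>x. trig_sum v x * cnj (trig_sum v x)) has_integral
     (\<Sum>j<dim_vec v. \<Sum>k<dim_vec v. v $ k * cnj (v $ j) * (if - (int j - int k) = 0 then 2 * pi else 0))) {0..2 * pi}"
    unfolding trig_sum_product
    by (intro has_integral_sum has_integral_mult_right has_integral_fourier_mode_period) auto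
  also have "(\<Sum>j<dim_vec v. \<Sum>k<dim_vec v. v $ k * cnj (v $ j) * (if - (int j - int k) = 0 then 2 * pi else 0))
     = (\<Sum>j<dim_vec v. \<Sum>k<dim_vec v. if j = k then of_real (2 * pi * (cmod (v $ k))\<^sup>2) else 0)"
    by (intro sum.cong refl) (auto simp: cnj_mult_self)
  also have "\<dots> = of_real (2 * pi * vnorm_sq v)"
    by (simp add: vnorm_sq_def sum_distrib_left)
  finally have "((\<lambda>x. trig_sum v x * cnj (trig_sum v x)) has_integral of_real (2 * pi * vnorm_sq v)) {0..2 * pi}" .
  from has_integral_linear[OF this bounded_linear_Re]
  show ?thesis by (simp add: o_def cnj_mult_self(2) flip: of_real_power)
qed

text \<open>With \<open>w = T\<^sub>n(\<phi>) v\<close> the number \<open>|w|\<^sup>2\<close> is the mean of \<open>\<phi> V W\<^sup>*\<close> for the associated trigonometric polynomials.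
  Bounding the integrand by \<open>(M\<^sup>2|V|\<^sup>2 + |W|\<^sup>2) / 2\<close> and using Parseval gives
  \<open>|w|\<^sup>2 \<le> (M\<^sup>2|v|\<^sup>2 + |w|\<^sup>2) / 2\<close>.\<close>

lemma vnorm_coeff_toeplitz_le:
  assumes reg: "regulated \<phi>" and M: "M \<ge> 0" and bound: "\<And>x. x \<in> {0..2 * pi} \<Longrightarrow> cmod (\<phi> x) \<le> M"
    and v: "v \<in> carrier_vec n"
  shows "vnorm (coeff_toeplitz n \<phi> *\<^sub>v v) \<le> M * vnorm v"
proof -
  define w where "w = coeff_toeplitz n \<phi> *\<^sub>v v"
  have w: "w \<in> carrier_vec n" "\<And>j. j < n \<Longrightarrow> w $ j = (\<Sum>k<n. fourier_coeff \<phi> (int j - int k) * v $ k)"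
  proof -
    show "w \<in> carrier_vec n"
      unfolding w_def coeff_toeplitz_def using v by (intro mult_mat_vec_carrier[of _ n n]) auto
    show "w $ j = (\<Sum>k<n. fourier_coeff \<phi> (int j - int k) * v $ k)" if "j < n" for j
      using v that by (auto simp: w_def coeff_toeplitz_def scalar_prod_def atLeast0LessThan)
  qed
  let ?F = "\<lambda>x. \<phi> x * (trig_sum v x * cnj (trig_sum w x))"
  have "((\<lambda>x. \<Sum>j<n. \<Sum>k<n. v $ k * cnj (w $ j) * (\<phi> x * fourier_mode (- (int j - int k)) x)) has_integral
     (\<Sum>j<n. \<Sum>k<n. v $ k * cnj (w $ j) * (2 * pi * fourier_coeff \<phi> (int j - int k)))) {0..2 * pi}"
    by (intro has_integral_sum has_integral_mult_right has_integral_fourier_coeff reg) auto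
  also have "(\<lambda>x. \<Sum>j<n. \<Sum>k<n. v $ k * cnj (w $ j) * (\<phi> x * fourier_mode (- (int j - int k)) x)) = ?F"
    unfolding trig_sum_product using v w(1) by (auto simp: sum_distrib_left mult_ac)
  also have "(\<Sum>j<n. \<Sum>k<n. v $ k * cnj (w $ j) * (2 * pi * fourier_coeff \<phi> (int j - int k)))
     = (\<Sum>j<n. 2 * pi * (w $ j * cnj (w $ j)))"
  proof (intro sum.cong refl)
    fix j assume "j \<in> {..<n}"
    have "(\<Sum>k<n. v $ k * z * (2 * pi * fourier_coeff \<phi> (int j - int k)))
       = 2 * pi * ((\<Sum>k<n. fourier_coeff \<phi> (int j - int k) * v $ k) * z)" for z
      by (simp add: sum_distrib_left sum_distrib_right mult_ac)
    then show "(\<Sum>k<n. v $ k * cnj (w $ j) * (2 * pi * fourier_coeff \<phi> (int j - int k)))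
       = 2 * pi * (w $ j * cnj (w $ j))"
      using w(2)[of j] \<open>j \<in> {..<n}\<close> by simp
  qed
  also have "\<dots> = of_real (2 * pi * vnorm_sq w)"
    using w(1) by (simp add: vnorm_sq_def sum_distrib_left cnj_mult_self)
  finally have int: "(?F has_integral of_real (2 * pi * vnorm_sq w)) {0..2 * pi}" .
  have int2: "((\<lambda>x. (M\<^sup>2 * (cmod (trig_sum v x))\<^sup>2 + (cmod (trig_sum w x))\<^sup>2) / 2) has_integral
      (M\<^sup>2 * (2 * pi * vnorm_sq v) + 2 * pi * vnorm_sq w) / 2) {0..2 * pi}"
    by (intro has_integral_divide has_integral_add has_integral_mult_right parseval_trig_sum)
  have "cmod (integral {0..2 * pi} ?F) \<le> integral {0..2 * pi} (\<lambda>x. (M\<^sup>2 * (cmod (trig_sum v x))\<^sup>2 + (cmod (trig_sum w x))\<^sup>2) / 2)"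
  proof (rule integral_norm_bound_integral)
    fix x assume x: "x \<in> {0..2 * pi}"
    have "cmod (?F x) \<le> M * (cmod (trig_sum v x) * cmod (trig_sum w x))"
      using bound[OF x] by (simp add: norm_mult mult_right_mono)
    also have "\<dots> \<le> (M\<^sup>2 * (cmod (trig_sum v x))\<^sup>2 + (cmod (trig_sum w x))\<^sup>2) / 2"
      using sum_squares_bound[of "M * cmod (trig_sum v x)" "cmod (trig_sum w x)"] by (simp add: power_mult_distrib)
    finally show "cmod (?F x) \<le> (M\<^sup>2 * (cmod (trig_sum v x))\<^sup>2 + (cmod (trig_sum w x))\<^sup>2) / 2" .
  qed (use int int2 in auto)
  then have "2 * pi * vnorm_sq w \<le> (M\<^sup>2 * (2 * pi * vnorm_sq v) + 2 * pi * vnorm_sq w) / 2"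
    unfolding integral_unique[OF int] integral_unique[OF int2] norm_of_real by simp
  then have "2 * pi * vnorm_sq w \<le> 2 * pi * (M\<^sup>2 * vnorm_sq v)" by (simp add: algebra_simps)
  then have "vnorm_sq w \<le> M\<^sup>2 * vnorm_sq v" by simp
  then have "vnorm w \<le> sqrt (M\<^sup>2 * vnorm_sq v)" unfolding vnorm_def by (rule real_sqrt_le_mono)
  then show ?thesis using M unfolding w_def vnorm_def by (simp add: real_sqrt_mult)
qed

section \<open>Circulant matrices\<close>

lemma fourier_mat_carrier [simp]: "fourier_mat n \<in> carrier_mat n n"
  by (simp add: fourier_mat_def)

lemma fourier_mat_entry:
  assumes "j < n" "k < n"
  shows "fourier_mat n $$ (j, k) = of_real (1 / sqrt (real n)) * fourier_mode (int k) (2 * pi * real j / real n)"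
proof -
  have "exp (2 * of_real pi * \<i> / of_nat n) = cis (2 * pi / real n)"
    by (simp add: cis_conv_exp mult_ac)
  then have "exp (2 * of_real pi * \<i> / of_nat n) ^ (j * k) = cis (real (j * k) * (2 * pi / real n))"
    by (simp only: Complex.DeMoivre)
  then show ?thesis using assms by (simp add: fourier_mat_def fourier_mode_cis mult_ac)
qed

lemma fourier_mat_entry_product:
  assumes "q < n" "j < n" "k < n"
  shows "cnj (fourier_mat n $$ (q, j)) * fourier_mat n $$ (q, k)
    = fourier_mode (- (int j - int k)) (2 * pi * real q / real n) / of_nat n"
proof -
  have "complex_of_real (1 / sqrt (real n)) * of_real (1 / sqrt (real n)) = 1 / of_nat n"
    unfolding of_real_mult[symmetric] by simp
  moreover have "fourier_mode (- int j) x * fourier_mode (int k) x = fourier_mode (- (int j - int k)) x" for x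
    by (simp add: fourier_mode_mult)
  moreover have "cnj (fourier_mat n $$ (q, j)) * fourier_mat n $$ (q, k)
    = (complex_of_real (1 / sqrt (real n)) * of_real (1 / sqrt (real n)))
       * (fourier_mode (- int j) (2 * pi * real q / real n) * fourier_mode (int k) (2 * pi * real q / real n))"
    using assms by (simp add: fourier_mat_entry cnj_fourier_mode)
  ultimately show ?thesis by simp
qed

lemma sum_fourier_mode_grid:
  assumes "\<bar>m\<bar> < int n"
  shows "(\<Sum>q<n. fourier_mode m (2 * pi * real q / real n)) = (if m = 0 then of_nat n else 0)"
proof (cases "m = 0")
  case False
  define z where "z = fourier_mode m (2 * pi / real n)"
  have n: "n > 0" using assms by auto
  have "z \<noteq> 1"
  proof
    assume "z = 1"
    then have "exp (\<i> * of_int m * of_real (2 * pi / real n)) = 1" by (simp add: z_def fourier_mode_def)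
    then obtain k :: int where "Im (\<i> * of_int m * of_real (2 * pi / real n)) = of_int (2 * k) * pi"
      unfolding exp_eq_1 by blast
    then have "real_of_int m = of_int k * real n" using n by (simp add: field_simps)
    then have "m = k * int n" using of_int_eq_iff[where 'a = real] by (metis of_int_mult of_int_of_nat_eq)
    then show False using assms False by (auto simp: abs_mult)
  qed
  have "(\<Sum>q=0..<n. z ^ q) * (1 - z) = z ^ 0 - z ^ n" by (rule geometric_sum_times) simp
  also have "z ^ n = 1" using n fourier_mode_power[of m n n] by (simp add: z_def)
  finally have "(\<Sum>q=0..<n. z ^ q) = 0" using \<open>z \<noteq> 1\<close> by simp
  then show ?thesis using False by (simp add: fourier_mode_power z_def atLeast0LessThan)
qed simp

lemma fourier_mat_unitary: "mat_adjoint (fourier_mat n) * fourier_mat n = 1\<^sub>m n"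
proof (rule eq_matI)
  fix j k assume "j < dim_row (1\<^sub>m n :: complex mat)" "k < dim_col (1\<^sub>m n :: complex mat)"
  then have jk: "j < n" "k < n" by auto
  have "(mat_adjoint (fourier_mat n) * fourier_mat n) $$ (j, k)
     = (\<Sum>q<n. cnj (fourier_mat n $$ (q, j)) * fourier_mat n $$ (q, k))"
    using jk carrier_matD[OF fourier_mat_carrier[of n]] by (simp add: scalar_prod_def atLeast0LessThan)
  also have "\<dots> = (\<Sum>q<n. fourier_mode (- (int j - int k)) (2 * pi * real q / real n)) / of_nat n"
    using jk by (simp add: fourier_mat_entry_product sum_divide_distrib)
  also have "\<dots> = (if j = k then 1 else 0)"
    using jk by (subst sum_fourier_mode_grid) auto
  finally show "(mat_adjoint (fourier_mat n) * fourier_mat n) $$ (j, k) = 1\<^sub>m n $$ (j, k)" using jk by simp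
qed (use carrier_matD[OF fourier_mat_carrier[of n]] in auto)

lemma fourier_mat_unitary': "fourier_mat n * mat_adjoint (fourier_mat n) = 1\<^sub>m n"
  by (rule mat_mult_left_right_inverse[OF _ _ fourier_mat_unitary]) auto

lemma circulant_carrier [simp]: "circulant n h \<in> carrier_mat n n"
  unfolding circulant_def
  by (intro mult_carrier_mat[of _ n n _ n]) (auto simp: mat_diag_def)

lemma circulant_entry:
  assumes "j < n" "k < n"
  shows "circulant n h $$ (j, k) = dft_coeff n h (int j - int k)"
proof -
  let ?F = "fourier_mat n"
  note F = carrier_matD[OF fourier_mat_carrier[of n]]
  have "mat_adjoint ?F * mat_diag n (\<lambda>k. h (2 * pi * real k / real n))
     = Matrix.mat n n (\<lambda>(i, j). mat_adjoint ?F $$ (i, j) * h (2 * pi * real j / real n))"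
    by (rule mat_diag_mult_right[of _ n n]) simp
  then have "circulant n h $$ (j, k)
     = (\<Sum>q<n. (cnj (?F $$ (q, j)) * ?F $$ (q, k)) * h (2 * pi * real q / real n))"
    unfolding circulant_def using assms F by (simp add: scalar_prod_def atLeast0LessThan mult_ac)
  also have "\<dots> = dft_coeff n h (int j - int k)"
    using assms unfolding dft_coeff_def sum_distrib_left
  proof (intro sum.cong refl)
    fix q assume "q \<in> {..<n}"
    then show "(cnj (?F $$ (q, j)) * ?F $$ (q, k)) * h (2 * pi * real q / real n)
       = 1 / of_nat n * (h (2 * pi * real q / real n) * fourier_mode (- (int j - int k)) (2 * pi * real q / real n))"
      using assms by (subst fourier_mat_entry_product) auto
  qed
  finally show ?thesis .
qed

lemma circulant_mult: "circulant n h * circulant n k = circulant n (\<lambda>x. h x * k x)"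
proof -
  let ?F = "fourier_mat n" and ?D = "\<lambda>h. mat_diag n (\<lambda>k. h (2 * pi * real k / real n)) :: complex mat"
  note F = carrier_matD[OF fourier_mat_carrier[of n]]
  have D: "dim_row (?D h) = n" "dim_col (?D h) = n" for h by (auto simp: mat_diag_def)
  have "circulant n h * circulant n k = mat_adjoint ?F * ?D h * (?F * mat_adjoint ?F) * ?D k * ?F"
    unfolding circulant_def by (simp add: mat_assoc F D)
  also have "\<dots> = mat_adjoint ?F * (?D h * ?D k) * ?F"
    unfolding fourier_mat_unitary' by (simp add: mat_assoc F D)
  also have "?D h * ?D k = ?D (\<lambda>x. h x * k x)"
    by (rule mat_diag_diag)
  finally show ?thesis unfolding circulant_def .
qed

lemma circulant_one: "circulant n (\<lambda>_. 1) = 1\<^sub>m n"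
  unfolding circulant_def
  by (simp add: mat_diag_one fourier_mat_unitary right_mult_one_mat[of _ n n])

lemma circulant_inverse:
  assumes "\<And>x. h x \<noteq> 0"
  shows "circulant n (\<lambda>x. 1 / h x) * circulant n h = 1\<^sub>m n"
  unfolding circulant_mult using assms by (simp add: circulant_one)

lemma vnorm_circulant_le:
  assumes M: "M \<ge> 0" and bound: "\<And>x. x \<in> {0..2 * pi} \<Longrightarrow> cmod (h x) \<le> M" and v: "v \<in> carrier_vec n"
  shows "vnorm (circulant n h *\<^sub>v v) \<le> M * vnorm v"
proof -
  let ?F = "fourier_mat n" and ?D = "mat_diag n (\<lambda>k. h (2 * pi * real k / real n))"
  have D: "?D \<in> carrier_mat n n" by (simp add: mat_diag_def)
  define y where "y = ?F *\<^sub>v v"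
  have y: "y \<in> carrier_vec n" unfolding y_def using v by (intro mult_mat_vec_carrier[of _ n n]) auto
  have "vnorm_sq (circulant n h *\<^sub>v v) = vnorm_sq (mat_adjoint ?F *\<^sub>v (?D *\<^sub>v y))"
    unfolding circulant_def y_def using D v
    by (simp add: assoc_mult_mat_vec[of _ n n _ n] mult_carrier_mat[of _ n n _ n] mult_mat_vec_carrier[of _ n n])
  also have "\<dots> \<le> vnorm_sq (?D *\<^sub>v y)"
    using D y by (intro vnorm_sq_adjoint_contraction[OF fourier_mat_carrier] mult_mat_vec_carrier[of _ n n])
      (auto simp: vnorm_sq_mult_isometry[OF fourier_mat_carrier fourier_mat_unitary])
  also have "?D *\<^sub>v y = vec n (\<lambda>i. h (2 * pi * real i / real n) * y $ i)"
    using y by (intro eq_vecI) (auto simp: mat_diag_def scalar_prod_def if_distrib[of "\<lambda>x. x * _"] cong: if_cong)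
  also have "vnorm_sq \<dots> \<le> M\<^sup>2 * vnorm_sq y"
  proof -
    have "(cmod (h (2 * pi * real i / real n) * y $ i))\<^sup>2 \<le> M\<^sup>2 * (cmod (y $ i))\<^sup>2" if "i < n" for i
    proof -
      have "2 * pi * real i / real n \<in> {0..2 * pi}" using that by (simp add: field_simps)
      from bound[OF this] show ?thesis
        unfolding norm_mult power_mult_distrib by (intro mult_right_mono power_mono) auto
    qed
    then have "(\<Sum>i<n. (cmod (h (2 * pi * real i / real n) * y $ i))\<^sup>2) \<le> (\<Sum>i<n. M\<^sup>2 * (cmod (y $ i))\<^sup>2)"
      by (intro sum_mono) auto
    then show ?thesis using y by (simp add: vnorm_sq_def sum_distrib_left)
  qed
  also have "vnorm_sq y = vnorm_sq v"
    unfolding y_def by (rule vnorm_sq_mult_isometry[OF fourier_mat_carrier fourier_mat_unitary v])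
  finally have "vnorm (circulant n h *\<^sub>v v) \<le> sqrt (M\<^sup>2 * vnorm_sq v)"
    unfolding vnorm_def by (rule real_sqrt_le_mono)
  then show ?thesis using M by (simp add: vnorm_def real_sqrt_mult)
qed

section \<open>Inverses\<close>

lemma mat_inv_eqI:
  assumes A: "A \<in> carrier_mat n n" and B: "B \<in> carrier_mat n n" and BA: "B * A = 1\<^sub>m n"
  shows "mat_inv A = B"
proof -
  have AB: "A * B = 1\<^sub>m n" by (rule mat_mult_left_right_inverse[OF B A BA])
  have "A \<in> Units (ring_mat TYPE(complex) n ())"
    unfolding Units_def ring_mat_def using A B AB BA by auto
  then obtain C where C: "mat_inverse A = Some C"
    using mat_inverse(1)[OF A, where b = "()"] by (cases "mat_inverse A") auto
  from mat_inverse(2)[OF A this] have "A * C = 1\<^sub>m n" "C \<in> carrier_mat n n" by auto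
  then have "B = (B * A) * C" using B A by (simp add: assoc_mult_mat[of B n n A n C n])
  also have "\<dots> = C" unfolding BA using \<open>C \<in> carrier_mat n n\<close> by simp
  finally have "C = B" by simp
  then show ?thesis unfolding mat_inv_def C by simp
qed

lemma mat_inv_inverse:
  assumes A: "A \<in> carrier_mat n n" and inv: "invertible_mat A"
  shows "mat_inv A \<in> carrier_mat n n" "mat_inv A * A = 1\<^sub>m n"
proof -
  obtain B where B: "inverts_mat A B" "inverts_mat B A" using inv unfolding invertible_mat_def by blast
  have AB: "A * B = 1\<^sub>m n" using B(1) A unfolding inverts_mat_def by auto
  have BA: "B * A = 1\<^sub>m (dim_row B)" using B(2) unfolding inverts_mat_def .
  have "dim_col B = n" using arg_cong[OF AB, of dim_col] by simp
  moreover have "dim_row B = n" using arg_cong[OF BA, of dim_col] A by simp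
  ultimately have "B \<in> carrier_mat n n" "B * A = 1\<^sub>m n" using BA by auto
  then show "mat_inv A \<in> carrier_mat n n" "mat_inv A * A = 1\<^sub>m n"
    using mat_inv_eqI[OF A, of B] by auto
qed

section \<open>Products of Toeplitz matrices\<close>

lemma integral_period_shift:
  assumes per: "\<And>x. F (x + 2 * pi) = (F x :: complex)" and int: "F integrable_on {0..2 * pi}"
  shows "integral {-pi..pi} F = integral {0..2 * pi} F"
proof -
  have int2: "F integrable_on {pi..2 * pi}" "F integrable_on {0..pi}"
    using integrable_on_subinterval[OF int] by auto
  have "(F has_integral integral {pi..2 * pi} F) {-pi + 2 * pi..0 + 2 * pi}"
    using integrable_integral[OF int2(1)] by simp
  then have "((F \<circ> (\<lambda>x. x + 2 * pi)) has_integral integral {pi..2 * pi} F) {-pi..0}"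
    using has_integral_shift_Icc_real[of F "2 * pi" "integral {pi..2 * pi} F" "-pi" 0]
    by (simp add: o_def add.commute)
  then have 1: "(F has_integral integral {pi..2 * pi} F) {-pi..0}"
    by (simp add: o_def per)
  have "(F has_integral integral {pi..2 * pi} F + integral {0..pi} F) {-pi..pi}"
    by (rule has_integral_combine[OF _ _ 1 integrable_integral[OF int2(2)]]) auto
  moreover have "integral {0..pi} F + integral {pi..2 * pi} F = integral {0..2 * pi} F"
    by (rule Henstock_Kurzweil_Integration.integral_combine[OF _ _ int]) auto
  ultimately show ?thesis by (simp add: integral_unique add.commute)
qed

lemma toeplitz_eq:
  assumes per: "periodic_2pi h" and reg: "regulated h"
  shows "toeplitz n h = coeff_toeplitz n h"
proof (rule eq_matI)
  fix j k assume jk: "j < dim_row (coeff_toeplitz n h)" "k < dim_col (coeff_toeplitz n h)"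
  have "integral {-pi..pi} (\<lambda>x. h x * fourier_mode (- (int j - int k)) x) = integral {0..2 * pi} (\<lambda>x. h x * fourier_mode (- (int j - int k)) x)"
    using per by (intro integral_period_shift regulated_integrable regulated_mult reg regulated_fourier_mode)
      (simp add: periodic_2pi_def fourier_mode_periodic)
  moreover have "(\<lambda>x. h x * exp (- \<i> * (of_nat j - of_nat k) * of_real x)) = (\<lambda>x. h x * fourier_mode (- (int j - int k)) x)"
    by (intro ext) (simp add: fourier_mode_def algebra_simps)
  ultimately show "toeplitz n h $$ (j, k) = coeff_toeplitz n h $$ (j, k)"
    using jk by (simp add: toeplitz_def coeff_toeplitz_def fourier_coeff_def)
qed (auto simp: toeplitz_def coeff_toeplitz_def)

text \<open>Multiplication by a trigonometric polynomial is a finite convolution of the coefficients.\<close>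

lemma fourier_coeff_trig_mult:
  assumes reg: "regulated h"
  shows "fourier_coeff (\<lambda>x. (\<Sum>i=-m..m. c i * fourier_mode i x) * h x) l = (\<Sum>i=-m..m. c i * fourier_coeff h (l - i))"
proof (rule fourier_coeffI)
  have "((\<lambda>x. \<Sum>i=-m..m. c i * (h x * fourier_mode (- (l - i)) x)) has_integral (\<Sum>i=-m..m. c i * (2 * pi * fourier_coeff h (l - i)))) {0..2 * pi}"
    by (intro has_integral_sum has_integral_mult_right has_integral_fourier_coeff reg) auto
  also have "(\<lambda>x. \<Sum>i=-m..m. c i * (h x * fourier_mode (- (l - i)) x)) = (\<lambda>x. (\<Sum>i=-m..m. c i * fourier_mode i x) * h x * fourier_mode (- l) x)"
  proof (intro ext)
    fix x
    have "fourier_mode (- (l - i)) x = fourier_mode i x * fourier_mode (- l) x" for i by (simp add: fourier_mode_mult)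
    then show "(\<Sum>i=-m..m. c i * (h x * fourier_mode (- (l - i)) x)) = (\<Sum>i=-m..m. c i * fourier_mode i x) * h x * fourier_mode (- l) x"
      by (simp add: sum_distrib_right sum_distrib_left mult_ac)
  qed
  also have "(\<Sum>i=-m..m. c i * (2 * pi * fourier_coeff h (l - i))) = 2 * pi * (\<Sum>i=-m..m. c i * fourier_coeff h (l - i))"
    by (simp add: sum_distrib_left mult_ac)
  finally show "((\<lambda>x. (\<Sum>i=-m..m. c i * fourier_mode i x) * h x * fourier_mode (- l) x) has_integral
     2 * pi * (\<Sum>i=-m..m. c i * fourier_coeff h (l - i))) {0..2 * pi}" .
qed

lemma fourier_coeff_trig:
  "fourier_coeff (\<lambda>x. \<Sum>i=-m..m. c i * fourier_mode i x) l = (if \<bar>l\<bar> \<le> m then c l else 0)"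
proof -
  have one: "fourier_coeff (\<lambda>_. 1) k = (if k = 0 then 1 else 0)" for k
  proof -
    have "fourier_mode 0 = (\<lambda>_. 1)" by (rule ext) simp
    then show ?thesis
      using has_integral_fourier_mode_period[of "- k"] by (intro fourier_coeffI) (cases "k = 0"; simp)
  qed
  have "fourier_coeff (\<lambda>x. (\<Sum>i=-m..m. c i * fourier_mode i x) * 1) l = (\<Sum>i=-m..m. c i * fourier_coeff (\<lambda>_. 1) (l - i))"
    by (rule fourier_coeff_trig_mult[OF regulated_const])
  also have "\<dots> = (\<Sum>i=-m..m. if i = l then c l else 0)"
    unfolding one by (intro sum.cong) auto
  finally show ?thesis by (auto simp: abs_le_iff)
qed

text \<open>The row \<open>j\<close> of \<open>T\<^sub>n(g)\<close> carries the whole convolution with the coefficients of \<open>g\<close> as soon as its band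
  \<open>{j - m..j + m}\<close> is not cut off by the border of the matrix.\<close>

lemma toeplitz_product_interior_rows:
  assumes reg: "regulated h" and j: "m \<le> j" "j + m < n" and k: "k < n"
    and g: "g = (\<lambda>x. \<Sum>i=-int m..int m. c i * fourier_mode i x)"
  shows "(coeff_toeplitz n g * coeff_toeplitz n h) $$ (j, k) = coeff_toeplitz n (\<lambda>x. g x * h x) $$ (j, k)"
proof -
  have jn: "j < n" using j by simp
  have "(coeff_toeplitz n g * coeff_toeplitz n h) $$ (j, k)
     = (\<Sum>p<n. fourier_coeff g (int j - int p) * fourier_coeff h (int p - int k))"
    using jn k by (simp add: coeff_toeplitz_def scalar_prod_def atLeast0LessThan)
  also have "\<dots> = (\<Sum>p\<in>{j - m..j + m}. fourier_coeff g (int j - int p) * fourier_coeff h (int p - int k))"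
    using j by (intro sum.mono_neutral_right) (auto simp: g fourier_coeff_trig)
  also have "\<dots> = (\<Sum>p\<in>{j - m..j + m}. c (int j - int p) * fourier_coeff h (int p - int k))"
    using j by (intro sum.cong refl) (auto simp: g fourier_coeff_trig)
  also have "\<dots> = (\<Sum>i=-int m..int m. c i * fourier_coeff h ((int j - int k) - i))"
    by (rule sum.reindex_bij_witness[of _ "\<lambda>i. nat (int j - i)" "\<lambda>p. int j - int p"])
      (use j in \<open>auto simp: algebra_simps\<close>)
  also have "\<dots> = fourier_coeff (\<lambda>x. g x * h x) (int j - int k)"
    unfolding g by (rule fourier_coeff_trig_mult[OF reg, symmetric])
  finally show ?thesis using jn k by (simp add: coeff_toeplitz_def)
qed

section \<open>Outliers of the preconditioned matrix\<close>

text \<open>The factor \<open>5 + 4 * ln n\<close> is positive also for \<open>n = 1\<close>, so that it can absorb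
  constants.\<close>

lemma preconditioned_outliers:
  assumes reg: "regulated h" and per: "periodic_2pi h"
    and c: "c > 0" "\<And>x. c \<le> cmod (h x)"
    and g: "g = (\<lambda>x. \<Sum>i=-int m..int m. a i * fourier_mode i x)"
    and f: "f = (\<lambda>x. g x * h x)"
    and inv: "\<And>n. n \<ge> 1 \<Longrightarrow> invertible_mat (toeplitz n g)"
    and \<epsilon>: "\<epsilon> > 0"
  shows "\<exists>K\<ge>0. \<forall>n>0. real (num_outside {1 - \<epsilon>..1 + \<epsilon>}
     (mat_inv (circulant n h) * mat_inv (toeplitz n g) * toeplitz n f)) \<le> K * (5 + 4 * ln (real n))"
proof -
  have regg: "regulated g" unfolding g
    by (intro regulated_continuous continuous_intros)
  have perg: "periodic_2pi g" unfolding g periodic_2pi_def by (simp add: fourier_mode_periodic)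
  have regf: "regulated f" unfolding f by (intro regulated_mult regg reg)
  have perf: "periodic_2pi f" using per perg unfolding f periodic_2pi_def by simp
  \<comment> \<open>The error is incurred in two matrices and multiplied by a norm of at most \<open>1 / c\<close>, so it uses up half of \<open>\<epsilon>\<close>.\<close>
  define \<eta> where "\<eta> = c * \<epsilon> / 4"
  have \<eta>: "\<eta> > 0" using c \<epsilon> by (simp add: \<eta>_def)
  obtain \<sigma> where \<sigma>: "step_fun \<sigma>" "\<And>x. x \<in> {0..2 * pi} \<Longrightarrow> cmod (h x - \<sigma> x) \<le> \<eta>"
    using regulated_step_approx[OF reg \<eta>] by blast
  obtain K where K: "K \<ge> 0" "\<And>n. n > 0 \<Longrightarrow> frobenius_sq (sampling_error n \<sigma>) \<le> K * (5 + 4 * ln (real n))"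
    using frobenius_sq_sampling_error_step[OF \<sigma>(1)] by blast
  define \<psi> where "\<psi> x = h x + (- 1) * \<sigma> x" for x
  have reg\<sigma>: "regulated \<sigma>" by (rule regulated_step_fun[OF \<sigma>(1)])
  have reg\<psi>: "regulated \<psi>" unfolding \<psi>_def by (intro regulated_add regulated_mult regulated_const reg reg\<sigma>)
  have \<psi>: "cmod (\<psi> x) \<le> \<eta>" if "x \<in> {0..2 * pi}" for x using \<sigma>(2)[OF that] by (simp add: \<psi>_def)
  have hnz: "h x \<noteq> 0" for x using c(1) c(2)[of x] by auto
  have bound: "real (num_outside {1 - \<epsilon>..1 + \<epsilon>}
     (mat_inv (circulant n h) * mat_inv (toeplitz n g) * toeplitz n f))
       \<le> (4 * real m + 8 / (c * \<epsilon>)\<^sup>2 * K) * (5 + 4 * ln (real n))" if n: "n > 0" for n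
  proof -
    define Ci where "Ci = circulant n (\<lambda>x. 1 / h x)"
    define Tg where "Tg = coeff_toeplitz n g"
    define Tf where "Tf = coeff_toeplitz n f"
    define Th where "Th = coeff_toeplitz n h"
    define Tgi where "Tgi = mat_inv Tg"
    have T: "toeplitz n g = Tg" "toeplitz n f = Tf" "toeplitz n h = Th"
      unfolding Tg_def Tf_def Th_def by (auto intro: toeplitz_eq regg perg regf perf reg per)
    have [simp]: "Ci \<in> carrier_mat n n" "Tg \<in> carrier_mat n n" "Tf \<in> carrier_mat n n" "Th \<in> carrier_mat n n"
      by (auto simp: Ci_def Tg_def Tf_def Th_def)
    have Ci: "mat_inv (circulant n h) = Ci"
      by (rule mat_inv_eqI[of _ n]) (auto simp: Ci_def circulant_inverse hnz)
    have Tgi: "Tgi \<in> carrier_mat n n" "Tgi * Tg = 1\<^sub>m n"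
      using mat_inv_inverse[of Tg n] inv[of n] n T by (auto simp: Tgi_def)
    \<comment> \<open>\<open>S\<close> has few nonzero rows, \<open>E0\<close> has small norm, and the squared Frobenius norm of \<open>L0\<close> grows logarithmically.\<close>
    define S where "S = Tf - Tg * Th"
    define E0 where "E0 = coeff_toeplitz n \<psi> + circulant n (\<lambda>x. (- 1) * \<psi> x)"
    define L0 where "L0 = sampling_error n \<sigma>"
    have S: "S \<in> carrier_mat n n" unfolding S_def
      by (intro minus_carrier_mat mult_carrier_mat[of _ n n _ n]) auto
    have E0: "E0 \<in> carrier_mat n n" and L0: "L0 \<in> carrier_mat n n" by (auto simp: E0_def L0_def)
    have Th: "Th = circulant n h + E0 + L0"
    proof (rule eq_matI)
      fix j k assume "j < dim_row (circulant n h + E0 + L0)" "k < dim_col (circulant n h + E0 + L0)"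
      then have jk: "j < n" "k < n" using L0 by auto
      let ?l = "int j - int k"
      have "fourier_coeff \<psi> ?l = fourier_coeff h ?l + (- 1) * fourier_coeff \<sigma> ?l"
        unfolding \<psi>_def fourier_coeff_add[OF reg regulated_mult[OF regulated_const reg\<sigma>]] fourier_coeff_cmult[OF reg\<sigma>] ..
      moreover have "dft_coeff n (\<lambda>x. (- 1) * \<psi> x) ?l = (- 1) * (dft_coeff n h ?l + (- 1) * dft_coeff n \<sigma> ?l)"
        unfolding dft_coeff_cmult unfolding \<psi>_def dft_coeff_add dft_coeff_cmult ..
      ultimately show "Th $$ (j, k) = (circulant n h + E0 + L0) $$ (j, k)"
        using jk circulant_carrier[of n h] circulant_carrier[of n "\<lambda>x. (- 1) * \<psi> x"]
        unfolding E0_def L0_def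
        by (simp add: Th_def coeff_toeplitz_def sampling_error_def circulant_entry carrier_matD[OF circulant_carrier])
    qed (use L0 in \<open>auto simp: Th_def coeff_toeplitz_def\<close>)
    have Tf: "Tf = Tg * Th + S"
      unfolding S_def by (rule eq_matI) (auto simp: carrier_matD[of Tf n n] carrier_matD[of Tg n n] carrier_matD[of Th n n])
    have A: "Ci * Tgi * Tf = 1\<^sub>m n + (Ci * Tgi) * S + Ci * E0 + Ci * L0"
    proof -
      have "Ci * Tgi * Tf = (Ci * Tgi) * (Tg * Th) + (Ci * Tgi) * S"
        unfolding Tf using Tgi S
        by (intro mult_add_distrib_mat[of _ n n _ n] mult_carrier_mat[of _ n n _ n]) auto
      also have "(Ci * Tgi) * (Tg * Th) = Ci * ((Tgi * Tg) * Th)"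
        using carrier_matD[OF Tgi(1)] carrier_matD[of Tg n n] carrier_matD[of Th n n] carrier_matD[of Ci n n]
        by (simp add: mat_assoc)
      also have "\<dots> = Ci * Th" unfolding Tgi(2) by (simp add: left_mult_one_mat[of _ n n])
      also have "\<dots> = Ci * (circulant n h + E0) + Ci * L0"
        unfolding Th using E0 L0 by (intro mult_add_distrib_mat[of _ n n _ n]) auto
      also have "Ci * (circulant n h + E0) = Ci * circulant n h + Ci * E0"
        using E0 by (intro mult_add_distrib_mat[of _ n n _ n]) auto
      also have "Ci * circulant n h = 1\<^sub>m n" unfolding Ci_def by (rule circulant_inverse) (rule hnz)
      finally have eq: "Ci * Tgi * Tf = 1\<^sub>m n + Ci * E0 + Ci * L0 + Ci * Tgi * S" .
      have c4: "a + b + d + e = a + e + b + d"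
        if "a \<in> carrier_mat n n" "b \<in> carrier_mat n n" "d \<in> carrier_mat n n" "e \<in> carrier_mat n n" for a b d e :: "complex mat"
        using that by (intro eq_matI) auto
      show ?thesis unfolding eq
        by (rule c4) (use E0 L0 S Tgi in \<open>auto intro!: mult_carrier_mat[of _ n n _ n]\<close>)
    qed
    have Ciop: "vnorm (Ci *\<^sub>v v) \<le> 1 / c * vnorm v" if "v \<in> carrier_vec n" for v
      unfolding Ci_def
    proof (rule vnorm_circulant_le[OF _ _ that])
      show "cmod (1 / h x) \<le> 1 / c" for x
        using c(1) c(2)[of x] by (simp add: norm_divide frac_le)
    qed (use c in simp)
    have op: "vnorm ((Ci * E0) *\<^sub>v v) \<le> \<epsilon> / 2 * vnorm v" if v: "v \<in> carrier_vec n" for v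
    proof -
      have "vnorm (E0 *\<^sub>v v) \<le> vnorm (coeff_toeplitz n \<psi> *\<^sub>v v) + vnorm (circulant n (\<lambda>x. (- 1) * \<psi> x) *\<^sub>v v)"
        unfolding E0_def using v
        by (subst add_mult_distrib_mat_vec[of _ n n]) (auto intro!: vnorm_triangle[of _ n] mult_mat_vec_carrier[of _ n n])
      also have "\<dots> \<le> \<eta> * vnorm v + \<eta> * vnorm v"
        using \<eta> \<psi> v by (intro add_mono vnorm_coeff_toeplitz_le vnorm_circulant_le reg\<psi>) (auto simp del: atLeastAtMost_iff)
      finally have "vnorm (E0 *\<^sub>v v) \<le> 2 * \<eta> * vnorm v" by simp
      then have "1 / c * vnorm (E0 *\<^sub>v v) \<le> 1 / c * (2 * \<eta> * vnorm v)" using c by (intro mult_left_mono) auto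
      also have "\<dots> = \<epsilon> / 2 * vnorm v" using c by (simp add: \<eta>_def)
      also have "vnorm ((Ci * E0) *\<^sub>v v) \<le> 1 / c * vnorm (E0 *\<^sub>v v)"
        using Ciop[of "E0 *\<^sub>v v"] E0 v by (simp add: assoc_mult_mat_vec[of Ci n n E0 n] mult_mat_vec_carrier[of E0 n n])
      ultimately show ?thesis by linarith
    qed
    have "frobenius_sq (Ci * L0) \<le> (1 / c)\<^sup>2 * frobenius_sq L0"
      by (rule frobenius_sq_mult_left_le[of _ n n _ n]) (use L0 Ciop vnorm_sq_le_of_vnorm in auto)
    also have "\<dots> \<le> (1 / c)\<^sup>2 * (K * (5 + 4 * ln (real n)))"
      unfolding L0_def using K(2)[OF n] by (intro mult_left_mono) auto
    finally have L: "frobenius_sq (Ci * L0) \<le> (1 / c)\<^sup>2 * (K * (5 + 4 * ln (real n)))" .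
    define J where "J = {..<m} \<union> {n - m..<n}"
    have J: "finite J" "card J \<le> 2 * m"
      using card_Un_le[of "{..<m}" "{n - m..<n}"] by (auto simp: J_def)
    have Srow: "S $$ (i, j) = 0" if "i < n" "i \<notin> J" "j < n" for i j
    proof -
      have "m \<le> i" "i + m < n" using that unfolding J_def by auto
      from toeplitz_product_interior_rows[OF reg this that(3) g]
      show ?thesis using that unfolding S_def Tf_def Tg_def Th_def f
        by (simp add: carrier_matD[OF coeff_toeplitz_carrier])
    qed
    have "real (num_outside {1 - \<epsilon>..1 + \<epsilon>} (Ci * Tgi * Tf))
       \<le> 2 * (real (card J) + frobenius_sq (Ci * L0) / (\<epsilon> - \<epsilon> / 2)\<^sup>2)"
      by (rule num_outside_le[OF _ _ _ A _ S _ _ J(1) Srow op])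
        (use \<epsilon> Tgi E0 L0 in \<open>auto intro!: mult_carrier_mat[of _ n n _ n]\<close>)
    also have "\<dots> \<le> 2 * (2 * real m + ((1 / c)\<^sup>2 * (K * (5 + 4 * ln (real n)))) / (\<epsilon> - \<epsilon> / 2)\<^sup>2)"
      using J(2) L by (intro mult_left_mono add_mono divide_right_mono) auto
    also have "\<dots> = 4 * real m + 8 / (c * \<epsilon>)\<^sup>2 * K * (5 + 4 * ln (real n))"
      using c \<epsilon> by (simp add: field_simps power2_eq_square)
    also have "\<dots> \<le> (4 * real m + 8 / (c * \<epsilon>)\<^sup>2 * K) * (5 + 4 * ln (real n))"
    proof -
      have "1 \<le> 5 + 4 * ln (real n)" using n by simp
      then have "4 * real m * 1 \<le> 4 * real m * (5 + 4 * ln (real n))" by (intro mult_left_mono) auto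
      then show ?thesis by (simp only: distrib_right)
    qed
    finally show ?thesis unfolding Ci T Tgi_def .
  qed
  show ?thesis
    by (rule exI[of _ "4 * real m + 8 / (c * \<epsilon>)\<^sup>2 * K"]) (use bound K(1) in auto)
qed

section \<open>Periodic functions and their zeros\<close>

lemma periodic_2pi_shift:
  assumes "periodic_2pi f" shows "f (x - 2 * pi * of_int k) = f x"
proof -
  have plus: "f (x + 2 * pi * real n) = f x" for x n
  proof (induction n)
    case (Suc n)
    have "f (x + 2 * pi * real (Suc n)) = f ((x + 2 * pi * real n) + 2 * pi)" by (simp add: algebra_simps)
    then show ?case using assms Suc unfolding periodic_2pi_def by simp
  qed simp
  show ?thesis
  proof (cases "k \<ge> 0")
    case True
    then show ?thesis using plus[of "x - 2 * pi * of_int k" "nat k"] by simp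
  next
    case False
    then show ?thesis using plus[of x "nat (- k)"] by simp
  qed
qed

lemma filtermap_at_left_shift: "filtermap (\<lambda>x. x - d) (at_left a) = at_left (a - d :: real)"
  unfolding filter_eq_iff eventually_filtermap eventually_at_left_field
proof (intro allI iffI)
  fix P assume "\<exists>b<a. \<forall>y>b. y < a \<longrightarrow> P (y - d)"
  then obtain b where "b < a" "\<And>y. y > b \<Longrightarrow> y < a \<Longrightarrow> P (y - d)" by blast
  then show "\<exists>b<a - d. \<forall>y>b. y < a - d \<longrightarrow> P y"
    using \<open>\<And>y. y > b \<Longrightarrow> y < a \<Longrightarrow> P (y - d)\<close>[of "_ + d"] by (intro exI[of _ "b - d"]) auto
next
  fix P assume "\<exists>b<a - d. \<forall>y>b. y < a - d \<longrightarrow> P y"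
  then obtain b where "b < a - d" "\<And>y. y > b \<Longrightarrow> y < a - d \<Longrightarrow> P y" by blast
  then show "\<exists>b<a. \<forall>y>b. y < a \<longrightarrow> P (y - d)"
    by (intro exI[of _ "b + d"]) auto
qed

lemma periodic_tendsto_shift:
  assumes "periodic_2pi f"
  shows "filterlim f F (at (x - 2 * pi * of_int k)) \<longleftrightarrow> filterlim f F (at x)"
    and "filterlim f F (at_left (x - 2 * pi * of_int k)) \<longleftrightarrow> filterlim f F (at_left x)"
    and "filterlim f F (at_right (x - 2 * pi * of_int k)) \<longleftrightarrow> filterlim f F (at_right x)"
  unfolding filtermap_at_shift[symmetric] filtermap_at_left_shift[symmetric] filtermap_at_right_shift[symmetric]
    filterlim_filtermap periodic_2pi_shift[OF assms] by auto

lemma period_representative: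
  obtains k :: int where "x - 2 * pi * of_int k \<in> {-pi<..pi}"
proof
  define k where "k = \<lceil>(x - pi) / (2 * pi)\<rceil>"
  have "(x - pi) / (2 * pi) \<le> of_int k" "of_int k < (x - pi) / (2 * pi) + 1"
    unfolding k_def by linarith+
  then show "x - 2 * pi * of_int k \<in> {-pi<..pi}" by (simp add: field_simps)
qed

lemma zero_at_shift:
  assumes "periodic_2pi f" shows "zero_at f (x - 2 * pi * of_int k) \<longleftrightarrow> zero_at f x"
  unfolding zero_at_def periodic_tendsto_shift[OF assms] periodic_2pi_shift[OF assms] ..

lemma piecewise_continuous_regulated:
  assumes "piecewise_continuous f" "periodic_2pi f" shows "regulated f"
  unfolding regulated_def
proof
  fix x
  obtain k :: int where "x - 2 * pi * of_int k \<in> {-pi<..pi}" by (rule period_representative)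
  then show "(\<exists>l. (f \<longlongrightarrow> l) (at_left x)) \<and> (\<exists>r. (f \<longlongrightarrow> r) (at_right x))"
    using assms(1) periodic_tendsto_shift[OF assms(2), of _ x k] unfolding piecewise_continuous_def by metis
qed

text \<open>At each point the value and both one-sided limits are nonzero, so the function is bounded away from zero
  nearby. Compactness of a period gives a uniform bound.\<close>

lemma regulated_bounded_below:
  assumes reg: "regulated h" and per: "periodic_2pi h" and nz: "\<And>x. \<not> zero_at h x"
  obtains c where "c > 0" "\<And>x. c \<le> cmod (h x)"
proof -
  have "\<exists>c>0. \<forall>x\<in>{-pi..pi}. c \<le> cmod (h x)"
  proof (rule Bolzano[where P = "\<lambda>a b. \<exists>c>0. \<forall>x\<in>{a..b}. c \<le> cmod (h x)"])
    fix a b d :: real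
    assume "\<exists>c>0. \<forall>x\<in>{a..b}. c \<le> cmod (h x)" "\<exists>c>0. \<forall>x\<in>{b..d}. c \<le> cmod (h x)"
    then obtain c1 c2 where c: "c1 > 0" "\<forall>x\<in>{a..b}. c1 \<le> cmod (h x)" "c2 > 0" "\<forall>x\<in>{b..d}. c2 \<le> cmod (h x)"
      by blast
    have "min c1 c2 \<le> cmod (h x)" if "x \<in> {a..d}" for x
      using c(2,4) that by (cases "x \<le> b") (auto simp: min_le_iff_disj)
    then show "\<exists>c>0. \<forall>x\<in>{a..d}. c \<le> cmod (h x)" using c(1,3) by (intro exI[of _ "min c1 c2"]) auto
  next
    fix x :: real
    obtain l r where l: "(h \<longlongrightarrow> l) (at_left x)" and r: "(h \<longlongrightarrow> r) (at_right x)"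
      using reg unfolding regulated_def by blast
    have ne: "l \<noteq> 0" "r \<noteq> 0" "h x \<noteq> 0" using nz[of x] l r unfolding zero_at_def by auto
    have el: "\<forall>\<^sub>F y in at_left x. cmod l / 2 < cmod (h y)"
      using ne by (intro order_tendstoD(1)[OF tendsto_norm[OF l]]) auto
    have er: "\<forall>\<^sub>F y in at_right x. cmod r / 2 < cmod (h y)"
      using ne by (intro order_tendstoD(1)[OF tendsto_norm[OF r]]) auto
    obtain u where u: "u < x" "\<And>y. u < y \<Longrightarrow> y < x \<Longrightarrow> cmod l / 2 < cmod (h y)"
      using el unfolding eventually_at_left_field by blast
    obtain w where w: "x < w" "\<And>y. x < y \<Longrightarrow> y < w \<Longrightarrow> cmod r / 2 < cmod (h y)"
      using er unfolding eventually_at_right_field by blast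
    define c where "c = min (cmod (h x)) (min (cmod l / 2) (cmod r / 2))"
    have c: "c > 0" using ne by (simp add: c_def)
    have "c \<le> cmod (h y)" if "u < y" "y < w" for y
    proof -
      consider "y < x" | "y = x" | "y > x" by linarith
      then show ?thesis using u(2)[of y] w(2)[of y] that by cases (auto simp: c_def)
    qed
    then show "\<exists>d>0. \<forall>a b. a \<le> x \<and> x \<le> b \<and> b - a < d \<longrightarrow> (\<exists>c>0. \<forall>x\<in>{a..b}. c \<le> cmod (h x))"
      using u(1) w(1) c by (intro exI[of _ "min (x - u) (w - x)"]) (auto intro!: exI[of _ c])
  qed simp
  then obtain c where c: "c > 0" "\<And>x. x \<in> {-pi..pi} \<Longrightarrow> c \<le> cmod (h x)" by blast
  have "c \<le> cmod (h x)" for x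
  proof -
    obtain k :: int where "x - 2 * pi * of_int k \<in> {-pi<..pi}" by (rule period_representative)
    then show ?thesis using c(2)[of "x - 2 * pi * of_int k"] periodic_2pi_shift[OF per, of x k] by auto
  qed
  with c(1) show ?thesis using that by blast
qed

lemma num_outside_mono:
  assumes "S \<subseteq> S'" shows "num_outside S' A \<le> num_outside S A"
  unfolding num_outside_def
  by (intro size_mset_mono filter_mset_mono_strong) (use assms in auto)

section \<open>The extended quotient\<close>

lemma extended_quotient_periodic:
  assumes "periodic_2pi f" "periodic_2pi g"
  shows "periodic_2pi (extended_quotient f g)"
proof -
  have q: "periodic_2pi (\<lambda>t. f t / g t)" using assms by (simp add: periodic_2pi_def)
  have "Lim (at (x + 2 * pi)) (\<lambda>t. f t / g t) = Lim (at x) (\<lambda>t. f t / g t)" for x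
    using periodic_tendsto_shift(1)[OF q, of _ "x" "-1"] by (simp add: t2_space_class.Lim_def)
  then show ?thesis using assms by (simp add: periodic_2pi_def extended_quotient_def)
qed

text \<open>Because of \<open>t / 0 = 0\<close>, a nonzero limit of the quotient excludes further zeros of \<open>g\<close> nearby.
  So the zeros of \<open>g\<close> are isolated, and the extended quotient agrees with \<open>f / g\<close> around each of them.\<close>

lemma extended_quotient_at_zero:
  assumes ext: "continuously_extendable_quotient f g" and nz: "\<not> zero_at (extended_quotient f g) x" and gx: "g x = 0"
  obtains L where "L \<noteq> 0" "((\<lambda>t. f t / g t) \<longlongrightarrow> L) (at x)" "(extended_quotient f g \<longlongrightarrow> L) (at x)"
proof -
  obtain L where L: "((\<lambda>t. f t / g t) \<longlongrightarrow> L) (at x)"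
    using ext gx unfolding continuously_extendable_quotient_def by blast
  have "extended_quotient f g x = L"
    using tendsto_Lim[OF _ L] gx by (simp add: extended_quotient_def)
  then have L0: "L \<noteq> 0" using nz unfolding zero_at_def by auto
  then have "\<forall>\<^sub>F t in at x. f t / g t \<noteq> 0" using L by (rule tendsto_imp_eventually_ne[rotated])
  then have "\<forall>\<^sub>F t in at x. f t / g t = extended_quotient f g t"
    by eventually_elim (auto simp: extended_quotient_def)
  with L have "(extended_quotient f g \<longlongrightarrow> L) (at x)" by (rule Lim_transform_eventually)
  with L0 L that show ?thesis by blast
qed

lemma extended_quotient_regulated:
  assumes reg: "regulated f" and g: "continuous_on UNIV g"
    and ext: "continuously_extendable_quotient f g" and nz: "\<And>x. \<not> zero_at (extended_quotient f g) x"
  shows "regulated (extended_quotient f g)"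
  unfolding regulated_def
proof
  fix x
  show "(\<exists>l. (extended_quotient f g \<longlongrightarrow> l) (at_left x)) \<and> (\<exists>r. (extended_quotient f g \<longlongrightarrow> r) (at_right x))"
  proof (cases "g x = 0")
    case True
    then obtain L where "(extended_quotient f g \<longlongrightarrow> L) (at x)"
      using extended_quotient_at_zero[OF ext nz] by metis
    then show ?thesis unfolding filterlim_at_split by blast
  next
    case False
    have gx: "(g \<longlongrightarrow> g x) (at x)" using g by (simp add: continuous_on_eq_continuous_at isCont_def)
    then have gl: "(g \<longlongrightarrow> g x) (at_left x)" and gr: "(g \<longlongrightarrow> g x) (at_right x)" by (simp_all add: filterlim_at_split)
    obtain l r where lr: "(f \<longlongrightarrow> l) (at_left x)" "(f \<longlongrightarrow> r) (at_right x)" using reg unfolding regulated_def by blast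
    have "\<forall>\<^sub>F t in at_left x. f t / g t = extended_quotient f g t"
      using tendsto_imp_eventually_ne[OF gl False] by eventually_elim (simp add: extended_quotient_def)
    moreover have "\<forall>\<^sub>F t in at_right x. f t / g t = extended_quotient f g t"
      using tendsto_imp_eventually_ne[OF gr False] by eventually_elim (simp add: extended_quotient_def)
    ultimately show ?thesis
      using Lim_transform_eventually[OF tendsto_divide[OF lr(1) gl False]]
        Lim_transform_eventually[OF tendsto_divide[OF lr(2) gr False]] by blast
  qed
qed

text \<open>At a zero of \<open>g\<close> the limit of \<open>f\<close> is zero. Hence the point counts as a zero of \<open>f\<close>, so it is not a
  jump, and continuity there shows that the value of \<open>f\<close> is zero as well.\<close>

lemma quotient_times_denominator:
  assumes g: "continuous_on UNIV g" and per: "periodic_2pi f"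
    and ext: "continuously_extendable_quotient f g" and nz: "\<And>x. \<not> zero_at (extended_quotient f g) x"
    and disj: "zeros f \<inter> discontinuities f = {}"
  shows "f x = g x * extended_quotient f g x"
proof (cases "g x = 0")
  case True
  then obtain L where L: "L \<noteq> 0" "((\<lambda>t. f t / g t) \<longlongrightarrow> L) (at x)"
    using extended_quotient_at_zero[OF ext nz] by metis
  have gx: "(g \<longlongrightarrow> 0) (at x)" using g True by (simp add: continuous_on_eq_continuous_at isCont_def) metis
  have "\<forall>\<^sub>F t in at x. f t / g t \<noteq> 0" using L by (intro tendsto_imp_eventually_ne)
  then have "\<forall>\<^sub>F t in at x. f t / g t * g t = f t" by eventually_elim auto
  with tendsto_mult[OF L(2) gx] have "(f \<longlongrightarrow> L * 0) (at x)" by (rule Lim_transform_eventually)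
  then have zero: "zero_at f x" unfolding zero_at_def filterlim_at_split by simp
  obtain k :: int where k: "x - 2 * pi * of_int k \<in> {-pi<..pi}" by (rule period_representative)
  define y where "y = x - 2 * pi * of_int k"
  have zy: "zero_at f y" using zero zero_at_shift[OF per] unfolding y_def by blast
  then have "y \<in> zeros f" using k unfolding zeros_def y_def by simp
  then have "isCont f y" using disj k unfolding discontinuities_def y_def by blast
  then have "f y = 0" using zy zero_at_isCont by blast
  then show ?thesis using True periodic_2pi_shift[OF per, of x k] unfolding y_def by simp
qed (simp add: extended_quotient_def)

theorem mainTheorem13:
  fixes f g :: "real \<Rightarrow> complex"
    and f1 f2 :: "real \<Rightarrow> real"
    and k \<nu> :: nat
    and x \<xi> :: "nat \<Rightarrow> real"
    and \<alpha> :: "nat \<Rightarrow> complex"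
  assumes f: "f = (\<lambda>t. of_real (f1 t) + \<i> * of_real (f2 t))"
    and f1_even: "\<And>t. f1 (- t) = f1 t"
    and f2_odd: "\<And>t. f2 (- t) = - f2 t"
    and pc: "piecewise_continuous f"
    and per: "periodic_2pi f"
    and zeros_f: "inj_on x {1..k}" "x ` {1..k} = zeros f"
    and disc_f: "inj_on \<xi> {1..\<nu>}" "\<xi> ` {1..\<nu>} = discontinuities f"
    and jumps: "\<And>j. j \<in> {1..\<nu>} \<Longrightarrow>
       \<exists>l r. (f \<longlongrightarrow> l) (at_left (\<xi> j)) \<and> (f \<longlongrightarrow> r) (at_right (\<xi> j)) \<and> \<alpha> j = r - l"
    and distinct: "\<And>i j. i \<in> {1..k} \<Longrightarrow> j \<in> {1..\<nu>} \<Longrightarrow> x i \<noteq> \<xi> j"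
    and g: "trig_polynomial g"
    and ext: "continuously_extendable_quotient f g"
    and no_zeros: "zeros (extended_quotient f g) = {}"
    and inv: "\<And>n. n \<ge> 1 \<Longrightarrow> invertible_mat (toeplitz n g)"
  shows "\<forall>\<epsilon>>0.
     general_cluster {1 - \<epsilon>..1 + \<epsilon>}
       (\<lambda>n. mat_inv (circulant n (extended_quotient f g)) * mat_inv (toeplitz n g) * toeplitz n f) \<and>
     (\<lambda>n. real (num_outside {1 - \<epsilon>..1 + \<epsilon>}
       (mat_inv (circulant n (extended_quotient f g)) * mat_inv (toeplitz n g) * toeplitz n f)))
       \<in> O(\<lambda>n. ln (real n))"
proof (intro allI impI)
  fix \<epsilon> :: real assume \<epsilon>: "\<epsilon> > 0"
  define h where "h = extended_quotient f g"
  define A where "A n = mat_inv (circulant n h) * mat_inv (toeplitz n g) * toeplitz n f" for n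
  obtain m a where g_eq: "g = (\<lambda>t. \<Sum>j=-int m..int m. a j * fourier_mode j t)"
    using g unfolding trig_polynomial_def fourier_mode_def by (auto simp: fun_eq_iff)
  have g_cont: "continuous_on UNIV g" unfolding g_eq by (intro continuous_intros)
  have g_per: "periodic_2pi g" unfolding g_eq periodic_2pi_def by (simp add: fourier_mode_periodic)
  have h_per: "periodic_2pi h" unfolding h_def by (rule extended_quotient_periodic[OF per g_per])
  have nz: "\<not> zero_at h t" for t
  proof -
    obtain i :: int where "t - 2 * pi * of_int i \<in> {-pi<..pi}" by (rule period_representative)
    then show ?thesis
      using no_zeros zero_at_shift[OF h_per, of t i] unfolding zeros_def h_def by blast
  qed
  have "zeros f \<inter> discontinuities f = {}"
    unfolding zeros_f(2)[symmetric] disc_f(2)[symmetric] using distinct by auto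
  then have f_eq: "f = (\<lambda>t. g t * h t)"
    using quotient_times_denominator[OF g_cont per ext nz[unfolded h_def]] unfolding h_def by blast
  have h_reg: "regulated h"
    unfolding h_def
    by (rule extended_quotient_regulated[OF piecewise_continuous_regulated[OF pc per] g_cont ext nz[unfolded h_def]])
  obtain c where c: "c > 0" "\<And>t. c \<le> cmod (h t)"
    using regulated_bounded_below[OF h_reg h_per nz] by blast
  obtain K where K: "K \<ge> 0" "\<And>n. n > 0 \<Longrightarrow> real (num_outside {1 - \<epsilon>..1 + \<epsilon>} (A n)) \<le> K * (5 + 4 * ln (real n))"
    using preconditioned_outliers[OF h_reg h_per c g_eq f_eq inv \<epsilon>] unfolding A_def by blast
  have log: "(\<lambda>n. real (num_outside {1 - \<epsilon>..1 + \<epsilon>} (A n))) \<in> O(\<lambda>n. ln (real n))"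
  proof (rule bigoI[where c = "9 * K"])
    show "\<forall>\<^sub>F n in sequentially. norm (real (num_outside {1 - \<epsilon>..1 + \<epsilon>} (A n))) \<le> 9 * K * norm (ln (real n))"
      using eventually_ge_at_top[of 3]
    proof eventually_elim
      case (elim n)
      have "1 \<le> ln (real n)" using elim exp_le by (subst ln_ge_iff) auto
      then have "K * (5 + 4 * ln (real n)) \<le> K * (9 * ln (real n))" using K(1) by (intro mult_left_mono) auto
      then show ?case using K(2)[of n] elim by simp
    qed
  qed
  have "(\<lambda>n. real (num_outside (delta_extension \<delta> {1 - \<epsilon>..1 + \<epsilon>}) (A n))) \<in> o(\<lambda>n. real n)" for \<delta>
  proof -
    have "(\<lambda>n. real (num_outside (delta_extension \<delta> {1 - \<epsilon>..1 + \<epsilon>}) (A n)))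
        \<in> O(\<lambda>n. real (num_outside {1 - \<epsilon>..1 + \<epsilon>} (A n)))"
      by (intro bigoI[where c = 1] always_eventually allI) (simp add: num_outside_mono delta_extension_def)
    also note log
    also have "(\<lambda>n. ln (real n)) \<in> o(\<lambda>n. real n)"
      by (rule smalloI_tendsto[OF lim_ln_over_n]) (auto intro: eventually_mono[OF eventually_gt_at_top[of 0]])
    finally show ?thesis .
  qed
  then have "general_cluster {1 - \<epsilon>..1 + \<epsilon>} A" unfolding general_cluster_def by blast
  with log show "general_cluster {1 - \<epsilon>..1 + \<epsilon>}
       (\<lambda>n. mat_inv (circulant n (extended_quotient f g)) * mat_inv (toeplitz n g) * toeplitz n f) \<and>
     (\<lambda>n. real (num_outside {1 - \<epsilon>..1 + \<epsilon>}
       (mat_inv (circulant n (extended_quotient f g)) * mat_inv (toeplitz n g) * toeplitz n f)))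
       \<in> O(\<lambda>n. ln (real n))"
    unfolding A_def h_def by blast
qed

end
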